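(* Let $M$ be a Riemannian $n$-manifold, $n\ge 2$. If there exist a point $p\in M$ and a $k$-tuple $(n_1,\ldots,n_k)\in\mathcal S(n)$ with $\delta(n_1,\ldots,n_k)(p)>0$, then $M$ never admits a minimal isometric immersion into any Riemannian manifold with non-positive sectional curvature. In particular, $M$ never admits a minimal isometric immersion into any Euclidean space, for any codimension.
   Context: For an integer $n\ge 2$, $\mathcal S(n)$ denotes the finite set of all $k$-tuples $(n_1,\ldots,n_k)$ of integers with $2\le n_1,\ldots,n_k\le n-1$ and $n_1+\cdots+n_k\le n$, where $k$ ranges over the non-negative integers ($k=0$ gives the empty tuple $\emptyset$). Let $M$ be a Riemannian $n$-manifold with sectional curvature $K$. For an orthonormal basis $\{e_1,\ldots,e_n\}$ of $T_pM$, the scalar curvature at $p$ is $\tau(p)=\sum_{i<j}K(e_i\wedge e_j)$. For a subspace $L\subset T_pM$ of dimension $r\ge 2$ with orthonormal basis $\{e_1,\ldots,e_r\}$, $\tau(L)=\sum_{1\le\alpha<\beta\le r}K(e_\alpha\wedge e_\beta)$. For $(n_1,\ldots,n_k)\in\mathcal S(n)$ the $\delta$-invariant at $p$ is $$\delta(n_1,\ldots,n_k)(p)=\tau(p)-\inf\{\tau(L_1)+\cdots+\tau(L_k)\},$$ where $L_1,\ldots,L_k$ run over all $k$ mutually orthogonal subspaces of $T_pM$ with $\dim L_j=n_j$; in particular $\delta(\emptyset)=\tau$. An isometric immersion is minimal if its mean curvature vector vanishes identically. *)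

theory Defs
  imports "HOL-Analysis.Analysis" "HOL-Library.Function_Algebras"
begin

text \<open>Smoothness (\<open>C\<^sup>\<infinity>\<close>) of maps on open subsets of Euclidean spaces.\<close>

fun Ck_on :: "nat \<Rightarrow> 'e set \<Rightarrow> ('e::euclidean_space \<Rightarrow> 'f::real_normed_vector) \<Rightarrow> bool" where
  "Ck_on 0 S F \<longleftrightarrow> continuous_on S F"
| "Ck_on (Suc k) S F \<longleftrightarrow>
     (\<forall>x\<in>S. F differentiable (at x)) \<and> (\<forall>v. Ck_on k S (\<lambda>x. frechet_derivative F (at x) v))"

definition smooth_on :: "'e set \<Rightarrow> ('e::euclidean_space \<Rightarrow> 'f::real_normed_vector) \<Rightarrow> bool" where
  "smooth_on S F \<longleftrightarrow> (\<forall>k. Ck_on k S F)"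

definition ddir :: "('e::euclidean_space \<Rightarrow> 'f::real_normed_vector) \<Rightarrow> 'e \<Rightarrow> 'e \<Rightarrow> 'f" where
  "ddir F x v = frechet_derivative F (at x) v"


text \<open>A chart is a pair of its domain and its coordinate map; the values of the coordinate map
  outside the domain are irrelevant.  A tangent vector is the family of its coordinate
  representations, one for each chart of the atlas, related by the derivatives of the transition
  maps.  Such families are added and scaled pointwise, hence the following class instance.\<close>

instantiation "fun" :: (type, real_vector) real_vector
begin

definition scaleR_fun :: "real \<Rightarrow> ('a \<Rightarrow> 'b) \<Rightarrow> 'a \<Rightarrow> 'b" where
  "scaleR_fun a f = (\<lambda>x. a *\<^sub>R f x)"

instance
  by standard (simp_all add: scaleR_fun_def fun_eq_iff scaleR_add_right scaleR_add_left)

end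

type_synonym ('a, 'n) chart = "'a set \<times> ('a \<Rightarrow> real^'n)"
type_synonym ('a, 'n) tangent = "('a, 'n) chart \<Rightarrow> real^'n"

record ('a, 'n::finite) riemannian =
  mtop :: "'a topology"
  atlas :: "('a, 'n) chart set"
  metric_at :: "'a \<Rightarrow> ('a, 'n) tangent \<Rightarrow> ('a, 'n) tangent \<Rightarrow> real"

definition chart_image :: "('a, 'n::finite) chart \<Rightarrow> (real^'n) set" where
  "chart_image c = snd c ` fst c"

definition chart_inv :: "('a, 'n::finite) chart \<Rightarrow> real^'n \<Rightarrow> 'a" where
  "chart_inv c = inv_into (fst c) (snd c)"

definition transition :: "('a, 'n::finite) chart \<Rightarrow> ('a, 'n) chart \<Rightarrow> real^'n \<Rightarrow> real^'n" where
  "transition c d = snd d \<circ> chart_inv c"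

definition charts_at :: "('a, 'n::finite) riemannian \<Rightarrow> 'a \<Rightarrow> ('a, 'n) chart set" where
  "charts_at M p = {c \<in> atlas M. p \<in> fst c}"

definition smooth_manifold :: "('a, 'n::finite) riemannian \<Rightarrow> bool" where
  "smooth_manifold M \<longleftrightarrow>
     Hausdorff_space (mtop M) \<and> second_countable (mtop M) \<and>
     (\<Union>c\<in>atlas M. fst c) = topspace (mtop M) \<and>
     (\<forall>c\<in>atlas M. openin (mtop M) (fst c) \<and> open (chart_image c) \<and>
        homeomorphic_map (subtopology (mtop M) (fst c)) (top_of_set (chart_image c)) (snd c)) \<and>
     (\<forall>c\<in>atlas M. \<forall>d\<in>atlas M. smooth_on (snd c ` (fst c \<inter> fst d)) (transition c d))"

definition tangent_space :: "('a, 'n::finite) riemannian \<Rightarrow> 'a \<Rightarrow> ('a, 'n) tangent set" where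
  "tangent_space M p =
     {v. (\<forall>c. c \<notin> charts_at M p \<longrightarrow> v c = 0) \<and>
         (\<forall>c\<in>charts_at M p. \<forall>d\<in>charts_at M p. v d = ddir (transition c d) (snd c p) (v c))}"

text \<open>The tangent vector at \<open>p\<close> whose coordinates in the chart \<open>c\<close> are \<open>x\<close>.\<close>

definition coord_vec ::
  "('a, 'n::finite) riemannian \<Rightarrow> ('a, 'n) chart \<Rightarrow> 'a \<Rightarrow> real^'n \<Rightarrow> ('a, 'n) tangent" where
  "coord_vec M c p x =
     (\<lambda>d. if d \<in> charts_at M p then ddir (transition c d) (snd c p) x else 0)"

definition chart_metric ::
  "('a, 'n::finite) riemannian \<Rightarrow> ('a, 'n) chart \<Rightarrow> real^'n \<Rightarrow> real^'n \<Rightarrow> real^'n \<Rightarrow> real" where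
  "chart_metric M c x u v =
     (let p = chart_inv c x in metric_at M p (coord_vec M c p u) (coord_vec M c p v))"

definition riemannian_manifold :: "('a, 'n::finite) riemannian \<Rightarrow> bool" where
  "riemannian_manifold M \<longleftrightarrow> smooth_manifold M \<and>
     (\<forall>p\<in>topspace (mtop M).
        (\<forall>u\<in>tangent_space M p. \<forall>v\<in>tangent_space M p. metric_at M p u v = metric_at M p v u) \<and>
        (\<forall>u\<in>tangent_space M p. \<forall>v\<in>tangent_space M p. \<forall>w\<in>tangent_space M p.
           metric_at M p (u + v) w = metric_at M p u w + metric_at M p v w) \<and>
        (\<forall>a. \<forall>u\<in>tangent_space M p. \<forall>v\<in>tangent_space M p.
           metric_at M p (a *\<^sub>R u) v = a * metric_at M p u v) \<and>
        (\<forall>u\<in>tangent_space M p. u \<noteq> 0 \<longrightarrow> metric_at M p u u > 0)) \<and>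
     (\<forall>c\<in>atlas M. \<forall>u v. smooth_on (chart_image c) (\<lambda>x. chart_metric M c x u v))"


text \<open>The Levi-Civita connection and its curvature for a metric \<open>G\<close> on an open subset of
  \<open>real^'n\<close>.  \<open>christoffel G x u v\<close> is the covariant derivative at \<open>x\<close> of the constant field \<open>v\<close> in
  direction \<open>u\<close>, characterised by the Koszul formula for constant fields; with respect to the
  coordinate basis its components are the usual Christoffel symbols.  \<open>chart_curvature G x u v w\<close>
  is \<open>R(u,v)w\<close> with the sign convention \<open>R(u,v)w = \<nabla>\<^sub>u\<nabla>\<^sub>v w - \<nabla>\<^sub>v\<nabla>\<^sub>u w - \<nabla>\<^bsub>[u,v]\<^esub> w\<close>, where the last
  term vanishes for constant fields.\<close>

definition christoffel ::
  "(real^'n \<Rightarrow> real^'n \<Rightarrow> real^'n \<Rightarrow> real) \<Rightarrow> real^'n \<Rightarrow> real^'n \<Rightarrow> real^'n \<Rightarrow> real^'n::finite" where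
  "christoffel G x u v =
     (THE z. \<forall>w. 2 * G x z w =
        ddir (\<lambda>y. G y v w) x u + ddir (\<lambda>y. G y u w) x v - ddir (\<lambda>y. G y u v) x w)"

definition chart_curvature ::
  "(real^'n \<Rightarrow> real^'n \<Rightarrow> real^'n \<Rightarrow> real) \<Rightarrow> real^'n \<Rightarrow> real^'n \<Rightarrow> real^'n \<Rightarrow> real^'n \<Rightarrow> real^'n::finite"
  where
  "chart_curvature G x u v w =
     ddir (\<lambda>y. christoffel G y v w) x u - ddir (\<lambda>y. christoffel G y u w) x v
     + christoffel G x u (christoffel G x v w) - christoffel G x v (christoffel G x u w)"

text \<open>Curvature and second fundamental form are tensors, so the tangent vectors defined below by
  coordinate expressions do not depend on the charts chosen by \<open>chart_at\<close>.\<close>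

definition chart_at :: "('a, 'n::finite) riemannian \<Rightarrow> 'a \<Rightarrow> ('a, 'n) chart" where
  "chart_at M p = (SOME c. c \<in> charts_at M p)"

definition curvature ::
  "('a, 'n::finite) riemannian \<Rightarrow> 'a \<Rightarrow> ('a, 'n) tangent \<Rightarrow> ('a, 'n) tangent \<Rightarrow> ('a, 'n) tangent \<Rightarrow>
   ('a, 'n) tangent" where
  "curvature M p u v w =
     (let c = chart_at M p
      in coord_vec M c p (chart_curvature (chart_metric M c) (snd c p) (u c) (v c) (w c)))"

definition sectional_curvature ::
  "('a, 'n::finite) riemannian \<Rightarrow> 'a \<Rightarrow> ('a, 'n) tangent \<Rightarrow> ('a, 'n) tangent \<Rightarrow> real" where
  "sectional_curvature M p u v =
     metric_at M p (curvature M p u v v) u /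
     (metric_at M p u u * metric_at M p v v - (metric_at M p u v)\<^sup>2)"

definition nonpositive_sectional_curvature :: "('a, 'n::finite) riemannian \<Rightarrow> bool" where
  "nonpositive_sectional_curvature M \<longleftrightarrow>
     (\<forall>p\<in>topspace (mtop M). \<forall>u\<in>tangent_space M p. \<forall>v\<in>tangent_space M p.
        u \<noteq> v \<and> independent {u, v} \<longrightarrow> sectional_curvature M p u v \<le> 0)"


text \<open>Orthonormal bases are listed as \<open>e 0, \<dots>, e (r - 1)\<close>.\<close>

definition orthonormal_basis_of ::
  "('a, 'n::finite) riemannian \<Rightarrow> 'a \<Rightarrow> ('a, 'n) tangent set \<Rightarrow> nat \<Rightarrow> (nat \<Rightarrow> ('a, 'n) tangent) \<Rightarrow> bool"
  where
  "orthonormal_basis_of M p L r e \<longleftrightarrow>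
     (\<forall>i<r. e i \<in> L) \<and> span (e ` {..<r}) = L \<and>
     (\<forall>i<r. \<forall>j<r. metric_at M p (e i) (e j) = (if i = j then 1 else 0))"

text \<open>\<open>\<tau>(L)\<close> does not depend on the orthonormal basis chosen.\<close>

definition scalar_curvature_sub ::
  "('a, 'n::finite) riemannian \<Rightarrow> 'a \<Rightarrow> ('a, 'n) tangent set \<Rightarrow> real" where
  "scalar_curvature_sub M p L =
     (let e = SOME e. orthonormal_basis_of M p L (dim L) e
      in \<Sum>j<dim L. \<Sum>i<j. sectional_curvature M p (e i) (e j))"

definition scalar_curvature :: "('a, 'n::finite) riemannian \<Rightarrow> 'a \<Rightarrow> real" where
  "scalar_curvature M p = scalar_curvature_sub M p (tangent_space M p)"

definition delta_tuples :: "nat \<Rightarrow> nat list set" where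
  "delta_tuples n = {ns. (\<forall>m\<in>set ns. 2 \<le> m \<and> m \<le> n - 1) \<and> sum_list ns \<le> n}"

definition orthogonal_subspaces ::
  "('a, 'n::finite) riemannian \<Rightarrow> 'a \<Rightarrow> nat list \<Rightarrow> ('a, 'n) tangent set list \<Rightarrow> bool" where
  "orthogonal_subspaces M p ns Ls \<longleftrightarrow>
     length Ls = length ns \<and>
     (\<forall>j<length ns. subspace (Ls ! j) \<and> Ls ! j \<subseteq> tangent_space M p \<and> dim (Ls ! j) = ns ! j) \<and>
     (\<forall>i<length ns. \<forall>j<length ns. i \<noteq> j \<longrightarrow>
        (\<forall>u\<in>Ls ! i. \<forall>v\<in>Ls ! j. metric_at M p u v = 0))"

definition delta_invariant :: "('a, 'n::finite) riemannian \<Rightarrow> nat list \<Rightarrow> 'a \<Rightarrow> real" where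
  "delta_invariant M ns p =
     scalar_curvature M p
     - Inf {\<Sum>L\<leftarrow>Ls. scalar_curvature_sub M p L |Ls. orthogonal_subspaces M p ns Ls}"


definition local_rep ::
  "('a, 'n::finite) chart \<Rightarrow> ('b, 'm::finite) chart \<Rightarrow> ('a \<Rightarrow> 'b) \<Rightarrow> real^'n \<Rightarrow> real^'m" where
  "local_rep c d f = snd d \<circ> f \<circ> chart_inv c"

definition smooth_map ::
  "('a, 'n::finite) riemannian \<Rightarrow> ('b, 'm::finite) riemannian \<Rightarrow> ('a \<Rightarrow> 'b) \<Rightarrow> bool" where
  "smooth_map M N f \<longleftrightarrow> continuous_map (mtop M) (mtop N) f \<and>
     (\<forall>c\<in>atlas M. \<forall>d\<in>atlas N. smooth_on (snd c ` (fst c \<inter> f -` fst d)) (local_rep c d f))"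

definition differential ::
  "('a, 'n::finite) riemannian \<Rightarrow> ('b, 'm::finite) riemannian \<Rightarrow> ('a \<Rightarrow> 'b) \<Rightarrow> 'a \<Rightarrow>
   ('a, 'n) tangent \<Rightarrow> ('b, 'm) tangent" where
  "differential M N f p v =
     (let c = chart_at M p
      in (\<lambda>d. if d \<in> charts_at N (f p) then ddir (local_rep c d f) (snd c p) (v c) else 0))"

definition isometric_immersion ::
  "('a, 'n::finite) riemannian \<Rightarrow> ('b, 'm::finite) riemannian \<Rightarrow> ('a \<Rightarrow> 'b) \<Rightarrow> bool" where
  "isometric_immersion M N f \<longleftrightarrow> smooth_map M N f \<and>
     (\<forall>p\<in>topspace (mtop M).
        inj_on (differential M N f p) (tangent_space M p) \<and>
        (\<forall>u\<in>tangent_space M p. \<forall>v\<in>tangent_space M p.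
           metric_at N (f p) (differential M N f p u) (differential M N f p v)
           = metric_at M p u v))"

text \<open>By the Gauss formula, the second fundamental form of an isometric immersion \<open>f\<close> is
  \<open>h(X,Y) = \<nabla>\<^sup>N\<^sub>X (df Y) - df (\<nabla>\<^sup>M\<^sub>X Y)\<close>.  Below this is evaluated in charts for the vector fields with
  constant coordinates; \<open>\<nabla>\<^sup>N\<^sub>X\<close> is the covariant derivative of vector fields along \<open>f\<close>.\<close>

definition second_fundamental_form ::
  "('a, 'n::finite) riemannian \<Rightarrow> ('b, 'm::finite) riemannian \<Rightarrow> ('a \<Rightarrow> 'b) \<Rightarrow> 'a \<Rightarrow>
   ('a, 'n) tangent \<Rightarrow> ('a, 'n) tangent \<Rightarrow> ('b, 'm) tangent" where
  "second_fundamental_form M N f p u v =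
     (let c = chart_at M p; d = chart_at N (f p); F = local_rep c d f; x = snd c p
      in coord_vec N d (f p)
           (ddir (\<lambda>y. ddir F y (v c)) x (u c)
            + christoffel (chart_metric N d) (F x) (ddir F x (u c)) (ddir F x (v c))
            - ddir F x (christoffel (chart_metric M c) x (u c) (v c))))"

definition mean_curvature ::
  "('a, 'n::finite) riemannian \<Rightarrow> ('b, 'm::finite) riemannian \<Rightarrow> ('a \<Rightarrow> 'b) \<Rightarrow> 'a \<Rightarrow> ('b, 'm) tangent"
  where
  "mean_curvature M N f p =
     (let e = SOME e. orthonormal_basis_of M p (tangent_space M p) CARD('n) e
      in (1 / real CARD('n)) *\<^sub>R (\<Sum>i<CARD('n). second_fundamental_form M N f p (e i) (e i)))"

definition minimal_isometric_immersion ::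
  "('a, 'n::finite) riemannian \<Rightarrow> ('b, 'm::finite) riemannian \<Rightarrow> ('a \<Rightarrow> 'b) \<Rightarrow> bool" where
  "minimal_isometric_immersion M N f \<longleftrightarrow>
     isometric_immersion M N f \<and> (\<forall>p\<in>topspace (mtop M). mean_curvature M N f p = 0)"

definition euclidean_riemannian :: "(real^'m, 'm::finite) riemannian" where
  "euclidean_riemannian =
     \<lparr>mtop = euclidean, atlas = {(UNIV, id)}, metric_at = (\<lambda>p u v. u (UNIV, id) \<bullet> v (UNIV, id))\<rparr>"

end

theory Submission
  imports Defs
begin

text \<open>By the Gauss equation \<open>K\<^sub>M(a,b) = K\<^sub>N(df a, df b) + \<langle>h(a,a), h(b,b)\<rangle> - |h(a,b)|\<^sup>2\<close>, so non-positive
  curvature of the target gives \<open>K\<^sub>M(a,b) \<le> \<langle>h(a,a), h(b,b)\<rangle>\<close>.  Take an orthonormal basis adapted to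
  mutually orthogonal subspaces \<open>L\<^sub>1, \<dots>, L\<^sub>k\<close> and sum over the ordered pairs, \<open>a = b\<close> included,
  that do not lie in a common \<open>L\<^sub>j\<close>: the left-hand side becomes \<open>\<tau> - \<Sum>\<tau>(L\<^sub>j)\<close> (up to a factor 2), and since the trace of \<open>h\<close>
  vanishes, the right-hand side equals \<open>-\<Sum>|tr (h|L\<^sub>j)|\<^sup>2 \<le> 0\<close>.  Hence \<open>\<delta> \<le> 0\<close> at every point of a
  minimal submanifold.\<close>

section \<open>Smooth maps and directional derivatives\<close>

text \<open>The obstacle is that the two curvatures in the Gauss equation are separate coordinate
  expressions, that \<open>christoffel\<close> is a THE-description, and that scalar and mean
  curvature rest on SOME-choices of bases. All is therefore pulled back to one chart around
  \<open>p\<close> and one around \<open>f p\<close>. There the derivative of the Koszul expression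
  of the induced metric is computed in two ways, inside the domain and along the map; comparing them
  gives the Gauss equation without normal connection or shape operator. The chosen bases disappear
  because traces are the same in every orthonormal basis of a subspace. The factor 2 arises because
  \<open>\<tau>\<close> counts unordered pairs while traces run over ordered ones; the diagonal is
  harmless because the curvature form vanishes there and \<open>|h(a,a)|^2\<close> is nonnegative.
  Finally, a lower bound for all admissible sums bounds their infimum only if some admissible family
  of subspaces exists; the condition that the dimensions add up to at most \<open>n\<close> provides
  one.\<close>

lemma ddir_has_derivative:
  assumes "(F has_derivative F') (at x)"
  shows "ddir F x = F'"
  using frechet_derivative_at[OF assms] by (simp add: ddir_def fun_eq_iff)

lemma has_derivative_ddir:
  assumes "F differentiable (at x)"
  shows "(F has_derivative ddir F x) (at x)"
  using assms frechet_derivative_works[of F "at x"] by (simp add: ddir_def[abs_def])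

lemma ddir_cong_open:
  assumes "open S" "x \<in> S" "\<And>y. y \<in> S \<Longrightarrow> F y = G y" "F differentiable (at x)"
  shows "ddir F x = ddir G x"
proof -
  have "(G has_derivative ddir F x) (at x)"
    using has_derivative_transform_within_open[OF has_derivative_ddir[OF assms(4)] assms(1,2)] assms(3)
    by auto
  then show ?thesis by (simp add: ddir_has_derivative)
qed

lemma differentiable_cong_open:
  assumes "open S" "x \<in> S" "\<And>y. y \<in> S \<Longrightarrow> F y = G y" "F differentiable (at x)"
  shows "G differentiable (at x)"
  using assms has_derivative_transform_within_open unfolding differentiable_def by blast

lemma linear_ddir: "F differentiable (at x) \<Longrightarrow> linear (ddir F x)"
  using has_derivative_ddir has_derivative_linear by blast

lemma ddir_compose:
  assumes "F differentiable (at x)" "G differentiable (at (F x))"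
  shows "ddir (G \<circ> F) x v = ddir G (F x) (ddir F x v)"
  using ddir_has_derivative[OF diff_chain_at[OF has_derivative_ddir[OF assms(1)] has_derivative_ddir[OF assms(2)]]]
  by simp

lemma ddir_inner:
  assumes "F differentiable (at x)"
  shows "ddir (\<lambda>y. F y \<bullet> b) x u = ddir F x u \<bullet> b"
  using ddir_has_derivative[OF has_derivative_inner_left[OF has_derivative_ddir[OF assms]], of b]
  by (simp add: fun_eq_iff)

lemma smooth_on_differentiable: "smooth_on S F \<Longrightarrow> x \<in> S \<Longrightarrow> F differentiable (at x)"
  unfolding smooth_on_def using Ck_on.simps(2) by blast

lemma smooth_on_ddir: "smooth_on S F \<Longrightarrow> smooth_on S (\<lambda>x. ddir F x v)"
  unfolding smooth_on_def ddir_def using Ck_on.simps(2) by blast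

lemma smooth_on_continuous_on: "smooth_on S F \<Longrightarrow> continuous_on S F"
  unfolding smooth_on_def using Ck_on.simps(1) by blast

lemma Ck_on_subset: "Ck_on k S F \<Longrightarrow> T \<subseteq> S \<Longrightarrow> Ck_on k T F"
  by (induction k arbitrary: F) (auto intro: continuous_on_subset)

lemma smooth_on_subset: "smooth_on S F \<Longrightarrow> T \<subseteq> S \<Longrightarrow> smooth_on T F"
  unfolding smooth_on_def using Ck_on_subset by blast

lemma smooth_on_const:
  fixes c :: "'f::real_normed_vector"
  shows "smooth_on S (\<lambda>x. c)"
proof -
  have "Ck_on k S (\<lambda>x. c)" for k and c :: 'f
    by (induction k arbitrary: c) auto
  then show ?thesis by (simp add: smooth_on_def)
qed

section \<open>Symmetry of second derivatives\<close>

lemma has_real_derivative_along_line: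
  fixes f :: "'e::euclidean_space \<Rightarrow> real"
  assumes "f differentiable (at (p + s *\<^sub>R v))"
  shows "((\<lambda>s. f (p + s *\<^sub>R v)) has_real_derivative ddir f (p + s *\<^sub>R v) v) (at s)"
proof -
  have "((\<lambda>s. p + s *\<^sub>R v) has_derivative (\<lambda>t. t *\<^sub>R v)) (at s)"
    by (auto intro!: derivative_eq_intros)
  from diff_chain_at[OF this has_derivative_ddir[OF assms]]
  have "((\<lambda>s. f (p + s *\<^sub>R v)) has_derivative (\<lambda>t. ddir f (p + s *\<^sub>R v) (t *\<^sub>R v))) (at s)"
    by (simp add: o_def)
  moreover have "(\<lambda>t. ddir f (p + s *\<^sub>R v) (t *\<^sub>R v)) = (*) (ddir f (p + s *\<^sub>R v) v)"
    using linear_cmul[OF linear_ddir[OF assms]] by (auto simp: mult.commute)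
  ultimately show ?thesis by (simp add: has_field_derivative_def)
qed

text \<open>Two applications of the mean value theorem, one in direction \<open>u\<close> and one in
  direction \<open>v\<close>. The second difference on the left is symmetric in \<open>u\<close> and
  \<open>v\<close>, so exchanging them expresses the same number by the mixed derivative in the
  other order.\<close>

lemma second_difference_mvt:
  fixes f :: "'e::euclidean_space \<Rightarrow> real"
  assumes f: "\<And>y. y \<in> S \<Longrightarrow> f differentiable (at y)"
    and fu: "\<And>y. y \<in> S \<Longrightarrow> (\<lambda>z. ddir f z u) differentiable (at y)"
    and "0 < r"
    and S: "\<And>s t. 0 \<le> s \<Longrightarrow> s \<le> r \<Longrightarrow> 0 \<le> t \<Longrightarrow> t \<le> r \<Longrightarrow> x + s *\<^sub>R u + t *\<^sub>R v \<in> S"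
  shows "\<exists>s t. 0 \<le> s \<and> s \<le> r \<and> 0 \<le> t \<and> t \<le> r \<and>
           f (x + r *\<^sub>R u + r *\<^sub>R v) - f (x + r *\<^sub>R u) - f (x + r *\<^sub>R v) + f x
             = r\<^sup>2 * ddir (\<lambda>z. ddir f z u) (x + s *\<^sub>R u + t *\<^sub>R v) v"
proof -
  \<comment> \<open>The second difference is \<open>q r - q 0\<close>, so the first mean value point
    comes from \<open>q\<close> alone.\<close>
  define q where "q s = f ((x + r *\<^sub>R v) + s *\<^sub>R u) - f (x + s *\<^sub>R u)" for s
  have S': "x + s *\<^sub>R u \<in> S" if "0 \<le> s" "s \<le> r" for s
    using S[OF that, of 0] \<open>0 < r\<close> by simp
  have S'': "x + r *\<^sub>R v + s *\<^sub>R u \<in> S" if "0 \<le> s" "s \<le> r" for s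
    using S[OF that, of r] \<open>0 < r\<close> by (simp add: algebra_simps)
  have "(q has_real_derivative ddir f ((x + r *\<^sub>R v) + s *\<^sub>R u) u - ddir f (x + s *\<^sub>R u) u) (at s)"
    if "0 \<le> s" "s \<le> r" for s
    unfolding q_def
    by (intro derivative_intros has_real_derivative_along_line f S' S'' that)
  from MVT2[OF \<open>0 < r\<close> this] obtain s where s: "0 < s" "s < r"
    and qs: "q r - q 0 = r * (ddir f ((x + r *\<^sub>R v) + s *\<^sub>R u) u - ddir f (x + s *\<^sub>R u) u)"
    by auto
  have "((\<lambda>t. ddir f ((x + s *\<^sub>R u) + t *\<^sub>R v) u) has_real_derivative
        ddir (\<lambda>z. ddir f z u) ((x + s *\<^sub>R u) + t *\<^sub>R v) v) (at t)"
    if "0 \<le> t" "t \<le> r" for t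
    using s that by (intro has_real_derivative_along_line fu S) auto
  from MVT2[OF \<open>0 < r\<close> this] obtain t where t: "0 < t" "t < r"
    and "ddir f ((x + s *\<^sub>R u) + r *\<^sub>R v) u - ddir f (x + s *\<^sub>R u) u
           = r * ddir (\<lambda>z. ddir f z u) ((x + s *\<^sub>R u) + t *\<^sub>R v) v"
    by auto
  with qs have "q r - q 0 = r\<^sup>2 * ddir (\<lambda>z. ddir f z u) (x + s *\<^sub>R u + t *\<^sub>R v) v"
    by (simp add: power2_eq_square add.commute add.left_commute)
  then have "f (x + r *\<^sub>R u + r *\<^sub>R v) - f (x + r *\<^sub>R u) - f (x + r *\<^sub>R v) + f x
             = r\<^sup>2 * ddir (\<lambda>z. ddir f z u) (x + s *\<^sub>R u + t *\<^sub>R v) v"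
    by (simp add: q_def add.commute add.left_commute)
  with s t show ?thesis by (intro exI[of _ s] exI[of _ t]) auto
qed

text \<open>Schwarz's theorem. On small parallelograms both mixed derivatives reproduce the same
  second difference, so they share a value at points near \<open>x\<close>. If they differed by
  \<open>2 * e\<close> at \<open>x\<close>, continuity would keep each within \<open>e\<close> of
  its value there, and no value could be shared.\<close>

lemma ddir_commute_real:
  fixes f :: "'e::euclidean_space \<Rightarrow> real"
  assumes "smooth_on S f" "open S" "x \<in> S"
  shows "ddir (\<lambda>y. ddir f y u) x v = ddir (\<lambda>y. ddir f y v) x u"
proof (rule ccontr)
  assume neq: "\<not> ?thesis"
  define P where "P y = ddir (\<lambda>z. ddir f z u) y v" for y
  define Q where "Q y = ddir (\<lambda>z. ddir f z v) y u" for y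
  define e where "e = \<bar>P x - Q x\<bar> / 2"
  have e: "e > 0" using neq by (simp add: e_def P_def Q_def)
  have "continuous_on S P" "continuous_on S Q"
    unfolding P_def Q_def by (intro smooth_on_continuous_on smooth_on_ddir assms)+
  then have "isCont P x" "isCont Q x"
    using assms continuous_on_eq_continuous_at by blast+
  then have "\<exists>d1>0. \<forall>y. dist y x < d1 \<longrightarrow> dist (P y) (P x) < e"
    and "\<exists>d2>0. \<forall>y. dist y x < d2 \<longrightarrow> dist (Q y) (Q x) < e"
    using e unfolding continuous_at_eps_delta by simp_all
  then obtain d1 d2 where d: "d1 > 0" "\<And>y. dist y x < d1 \<Longrightarrow> dist (P y) (P x) < e"
      "d2 > 0" "\<And>y. dist y x < d2 \<Longrightarrow> dist (Q y) (Q x) < e"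
    by blast
  obtain d3 where d3: "d3 > 0" "\<And>y. dist y x < d3 \<Longrightarrow> y \<in> S"
    using assms(2,3) unfolding open_dist by blast
  define D where "D = min d1 (min d2 d3)"
  \<comment> \<open>The parallelogram with sides \<open>r *\<^sub>R u\<close> and
    \<open>r *\<^sub>R v\<close> then stays within \<open>D / 2\<close> of \<open>x\<close>; the
    summand 1 keeps the denominator positive when both vectors vanish.\<close>
  define r where "r = D / (2 * (norm u + norm v + 1))"
  have "D > 0" using d d3 by (simp add: D_def)
  have npos: "norm u + norm v + 1 > 0" by (simp add: add_nonneg_pos)
  have r: "r > 0" using \<open>D > 0\<close> npos by (simp add: r_def)
  have near: "dist (x + s *\<^sub>R u + t *\<^sub>R v) x < D" if "0 \<le> s" "s \<le> r" "0 \<le> t" "t \<le> r" for s t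
  proof -
    have "dist (x + s *\<^sub>R u + t *\<^sub>R v) x \<le> s * norm u + t * norm v"
      using norm_triangle_ineq[of "s *\<^sub>R u" "t *\<^sub>R v"] that by (simp add: dist_norm add.assoc)
    also have "\<dots> \<le> r * norm u + r * norm v"
      using that by (intro add_mono mult_right_mono) auto
    also have "\<dots> \<le> r * (norm u + norm v + 1)" using r by (simp add: algebra_simps)
    also have "\<dots> = D / 2"
      unfolding r_def using npos by (metis divide_divide_eq_left mult.commute nonzero_eq_divide_eq order_less_irrefl)
    also have "\<dots> < D" using \<open>D > 0\<close> by simp
    finally show ?thesis .
  qed
  have diff: "f differentiable (at y)" "(\<lambda>z. ddir f z w) differentiable (at y)" if "y \<in> S" for y w
    using smooth_on_differentiable[OF assms(1) that]
      smooth_on_differentiable[OF smooth_on_ddir[OF assms(1)] that] by auto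
  have nearS: "x + s *\<^sub>R u + t *\<^sub>R v \<in> S" if "0 \<le> s" "s \<le> r" "0 \<le> t" "t \<le> r" for s t
    using near[OF that] d3 by (simp add: D_def)
  obtain s t where st: "0 \<le> s" "s \<le> r" "0 \<le> t" "t \<le> r"
    "f (x + r *\<^sub>R u + r *\<^sub>R v) - f (x + r *\<^sub>R u) - f (x + r *\<^sub>R v) + f x
             = r\<^sup>2 * P (x + s *\<^sub>R u + t *\<^sub>R v)"
    using second_difference_mvt[OF diff(1) diff(2) r nearS] unfolding P_def by blast
  have near': "x + s *\<^sub>R v + t *\<^sub>R u \<in> S" if "0 \<le> s" "s \<le> r" "0 \<le> t" "t \<le> r" for s t
    using near[OF that(3,4,1,2)] d3 by (simp add: D_def add.commute add.left_commute)
  obtain s' t' where st': "0 \<le> s'" "s' \<le> r" "0 \<le> t'" "t' \<le> r"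
    "f (x + r *\<^sub>R v + r *\<^sub>R u) - f (x + r *\<^sub>R v) - f (x + r *\<^sub>R u) + f x
             = r\<^sup>2 * Q (x + s' *\<^sub>R v + t' *\<^sub>R u)"
    using second_difference_mvt[OF diff(1) diff(2) r near'] unfolding Q_def by blast
  have "r\<^sup>2 * P (x + s *\<^sub>R u + t *\<^sub>R v) = r\<^sup>2 * Q (x + s' *\<^sub>R v + t' *\<^sub>R u)"
  proof -
    have "x + r *\<^sub>R v + r *\<^sub>R u = x + r *\<^sub>R u + r *\<^sub>R v" by (simp add: algebra_simps)
    then show ?thesis using st(5) st'(5) by (metis add.commute diff_diff_eq)
  qed
  then have "P (x + s *\<^sub>R u + t *\<^sub>R v) = Q (x + s' *\<^sub>R v + t' *\<^sub>R u)"
    using r by simp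
  moreover have "dist (P (x + s *\<^sub>R u + t *\<^sub>R v)) (P x) < e"
    using near[OF st(1-4)] d by (simp add: D_def)
  moreover have "dist (Q (x + s' *\<^sub>R v + t' *\<^sub>R u)) (Q x) < e"
    using near[OF st'(3,4,1,2)] d by (simp add: D_def add.commute add.left_commute)
  ultimately have "\<bar>P x - Q x\<bar> < 2 * e"
    unfolding dist_real_def by linarith
  then show False by (simp add: e_def)
qed

lemma Ck_on_inner:
  fixes F :: "'e::euclidean_space \<Rightarrow> 'f::euclidean_space"
  assumes "Ck_on k S F" "open S" shows "Ck_on k S (\<lambda>x. F x \<bullet> b)"
  using assms(1)
proof (induction k arbitrary: F)
  case 0
  then show ?case by (auto intro: continuous_intros)
next
  case (Suc k)
  \<comment> \<open>The derivative of the inner product is known only at points of \<open>S\<close>,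
    where \<open>F\<close> is differentiable. Since \<open>S\<close> is open, derivatives at its
    points depend only on values in \<open>S\<close>, so agreement on \<open>S\<close> suffices at
    every order.\<close>
  have cong: "Ck_on k S A" if "Ck_on k S B" "\<And>x. x \<in> S \<Longrightarrow> A x = B x" for A B :: "'e \<Rightarrow> real"
    using that
  proof (induction k arbitrary: A B)
    case 0
    then show ?case by (auto cong: continuous_on_cong)
  next
    case (Suc k)
    have d: "A differentiable (at x)" "frechet_derivative A (at x) = frechet_derivative B (at x)"
      if x: "x \<in> S" for x
    proof -
      have "B differentiable (at x)" using Suc.prems x by auto
      then show "A differentiable (at x)" "frechet_derivative A (at x) = frechet_derivative B (at x)"
        using differentiable_cong_open[OF assms(2) x, of B A] ddir_cong_open[OF assms(2) x, of B A]
          Suc.prems(2) by (auto simp: ddir_def fun_eq_iff)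
    qed
    show ?case
      using d Suc.prems(1) Suc.IH[of "\<lambda>x. frechet_derivative B (at x) v" "\<lambda>x. frechet_derivative A (at x) v" for v]
      by auto
  qed
  have "(\<lambda>x. F x \<bullet> b) differentiable (at x)" if "x \<in> S" for x
    using Suc.prems that by auto
  moreover have "Ck_on k S (\<lambda>x. frechet_derivative (\<lambda>x. F x \<bullet> b) (at x) v)" for v
  proof (rule cong)
    show "Ck_on k S (\<lambda>x. frechet_derivative F (at x) v \<bullet> b)"
      using Suc by simp
    show "frechet_derivative (\<lambda>x. F x \<bullet> b) (at x) v = frechet_derivative F (at x) v \<bullet> b" if "x \<in> S" for x
      using ddir_inner[of F x b v] Suc.prems that by (simp add: ddir_def)
  qed
  ultimately show ?case by simp
qed

lemma ddir_commute:
  fixes F :: "'e::euclidean_space \<Rightarrow> 'f::euclidean_space"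
  assumes "smooth_on S F" "open S" "x \<in> S"
  shows "ddir (\<lambda>y. ddir F y u) x v = ddir (\<lambda>y. ddir F y v) x u"
proof (rule euclidean_eqI)
  fix b :: 'f
  have sm: "smooth_on S (\<lambda>x. F x \<bullet> b)"
    using assms Ck_on_inner unfolding smooth_on_def by blast
  have *: "ddir (\<lambda>y. ddir F y u) x v \<bullet> b = ddir (\<lambda>y. ddir (\<lambda>z. F z \<bullet> b) y u) x v" for u v
  proof -
    have d: "(\<lambda>y. ddir F y u) differentiable (at x)"
      by (rule smooth_on_differentiable[OF smooth_on_ddir[OF assms(1)] assms(3)])
    have "ddir (\<lambda>y. ddir F y u) x v \<bullet> b = ddir (\<lambda>y. ddir F y u \<bullet> b) x v"
      using ddir_inner[OF d] by simp
    also have "\<dots> = ddir (\<lambda>y. ddir (\<lambda>z. F z \<bullet> b) y u) x v"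
      by (subst ddir_cong_open[OF assms(2,3)])
        (use d in \<open>auto simp: ddir_inner smooth_on_differentiable[OF assms(1)]\<close>)
    finally show ?thesis .
  qed
  show "ddir (\<lambda>y. ddir F y u) x v \<bullet> b = ddir (\<lambda>y. ddir F y v) x u \<bullet> b"
    unfolding * by (rule ddir_commute_real[OF sm assms(2,3)])
qed

section \<open>Derivatives of bilinear families and determinants\<close>

lemma bilinear_expand:
  fixes T :: "'a::euclidean_space \<Rightarrow> 'b::euclidean_space \<Rightarrow> 'c::real_vector"
  assumes "bilinear T"
  shows "T a b = (\<Sum>i\<in>Basis. \<Sum>j\<in>Basis. (a \<bullet> i) *\<^sub>R (b \<bullet> j) *\<^sub>R T i j)"
proof -
  have l: "linear (T a)" "linear (\<lambda>a. T a b)" for a b using assms by (auto simp: bilinear_def)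
  have "T a b = T (\<Sum>i\<in>Basis. (a \<bullet> i) *\<^sub>R i) b" by (simp add: euclidean_representation)
  also have "\<dots> = (\<Sum>i\<in>Basis. (a \<bullet> i) *\<^sub>R T i b)"
    by (simp add: linear_sum[OF l(2)] linear_cmul[OF l(2)])
  also have "\<dots> = (\<Sum>i\<in>Basis. (a \<bullet> i) *\<^sub>R T i (\<Sum>j\<in>Basis. (b \<bullet> j) *\<^sub>R j))"
    by (simp add: euclidean_representation)
  also have "\<dots> = (\<Sum>i\<in>Basis. \<Sum>j\<in>Basis. (a \<bullet> i) *\<^sub>R (b \<bullet> j) *\<^sub>R T i j)"
    by (simp add: linear_sum[OF l(1)] linear_cmul[OF l(1)] scaleR_sum_right)
  finally show ?thesis .
qed

text \<open>A product rule that asks for differentiability of \<open>T\<close> only at fixed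
  arguments: expansion in the standard basis turns \<open>T y (X y) (Y y)\<close> into a finite sum
  of products of scalars. Bilinearity on a neighbourhood makes this expansion valid near
  \<open>x\<close>. It serves for metrics and for Christoffel symbols.\<close>

lemma has_derivative_bilinear_family:
  fixes T :: "'e::euclidean_space \<Rightarrow> 'a::euclidean_space \<Rightarrow> 'b::euclidean_space \<Rightarrow> 'c::real_normed_vector"
  assumes "open S" "x \<in> S" and bil: "\<And>y. y \<in> S \<Longrightarrow> bilinear (T y)"
    and T: "\<And>a b. (\<lambda>y. T y a b) differentiable (at x)"
    and X: "(X has_derivative X') (at x)" and Y: "(Y has_derivative Y') (at x)"
  shows "((\<lambda>y. T y (X y) (Y y)) has_derivative
          (\<lambda>h. ddir (\<lambda>y. T y (X x) (Y x)) x h + T x (X' h) (Y x) + T x (X x) (Y' h))) (at x)"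
proof -
  let ?E = "\<lambda>y. \<Sum>i\<in>Basis. \<Sum>j\<in>Basis. (X y \<bullet> i) *\<^sub>R (Y y \<bullet> j) *\<^sub>R T y i j"
  let ?D = "\<lambda>a b h. \<Sum>i\<in>Basis. \<Sum>j\<in>Basis. (a \<bullet> i) *\<^sub>R (b \<bullet> j) *\<^sub>R ddir (\<lambda>y. T y i j) x h"
  have D: "ddir (\<lambda>y. T y a b) x h = ?D a b h" for a b h
  proof -
    have "((\<lambda>y. \<Sum>i\<in>Basis. \<Sum>j\<in>Basis. (a \<bullet> i) *\<^sub>R (b \<bullet> j) *\<^sub>R T y i j) has_derivative ?D a b) (at x)"
      by (intro has_derivative_sum has_derivative_scaleR_right has_derivative_ddir T)
    then have "((\<lambda>y. T y a b) has_derivative ?D a b) (at x)"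
      by (rule has_derivative_transform_within_open[OF _ assms(1,2)])
        (rule bilinear_expand[OF bil, symmetric])
    then show ?thesis by (simp add: ddir_has_derivative)
  qed
  have "(?E has_derivative (\<lambda>h. \<Sum>i\<in>Basis. \<Sum>j\<in>Basis.
        (X x \<bullet> i) *\<^sub>R ((Y x \<bullet> j) *\<^sub>R ddir (\<lambda>y. T y i j) x h + (Y' h \<bullet> j) *\<^sub>R T x i j)
         + (X' h \<bullet> i) *\<^sub>R (Y x \<bullet> j) *\<^sub>R T x i j)) (at x)"
    by (intro has_derivative_sum has_derivative_scaleR has_derivative_inner_left
        has_derivative_ddir T X Y)
  moreover have "(\<lambda>h. \<Sum>i\<in>Basis. \<Sum>j\<in>Basis.
        (X x \<bullet> i) *\<^sub>R ((Y x \<bullet> j) *\<^sub>R ddir (\<lambda>y. T y i j) x h + (Y' h \<bullet> j) *\<^sub>R T x i j)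
         + (X' h \<bullet> i) *\<^sub>R (Y x \<bullet> j) *\<^sub>R T x i j) = 
      (\<lambda>h. ddir (\<lambda>y. T y (X x) (Y x)) x h + T x (X' h) (Y x) + T x (X x) (Y' h))"
    unfolding D[of "X x" "Y x"] bilinear_expand[OF bil[OF assms(2)], of "X' h" "Y x" for h]
      bilinear_expand[OF bil[OF assms(2)], of "X x" "Y' h" for h]
    by (simp add: scaleR_add_right sum.distrib add_ac)
  ultimately have "(?E has_derivative
      (\<lambda>h. ddir (\<lambda>y. T y (X x) (Y x)) x h + T x (X' h) (Y x) + T x (X x) (Y' h))) (at x)" by simp
  then show ?thesis
    by (rule has_derivative_transform_within_open[OF _ assms(1,2)])
      (rule bilinear_expand[OF bil, symmetric])
qed

lemma differentiable_prod:
  fixes f :: "'i \<Rightarrow> 'e::real_normed_vector \<Rightarrow> real"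
  assumes "\<And>i. i \<in> I \<Longrightarrow> f i differentiable (at x)"
  shows "(\<lambda>y. \<Prod>i\<in>I. f i y) differentiable (at x)"
proof -
  have "((\<lambda>y. \<Prod>i\<in>I. f i y) has_derivative
      (\<lambda>h. \<Sum>i\<in>I. frechet_derivative (f i) (at x) h * (\<Prod>j\<in>I - {i}. f j x))) (at x)"
    using assms by (intro has_derivative_prod) (simp add: frechet_derivative_works)
  then show ?thesis unfolding differentiable_def by blast
qed

text \<open>The determinant is a polynomial in the entries; this will make Cramer's formula
  differentiable.\<close>

lemma differentiable_det:
  fixes A :: "'e::real_normed_vector \<Rightarrow> real^'n^'n"
  assumes "\<And>i j. (\<lambda>y. A y $ i $ j) differentiable (at x)"
  shows "(\<lambda>y. det (A y)) differentiable (at x)"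
  unfolding det_def
proof (rule differentiable_sum)
  show "\<forall>p\<in>{p. p permutes (UNIV :: 'n set)}.
    (\<lambda>y. of_int (sign p) * (\<Prod>i\<in>UNIV. A y $ i $ p i)) differentiable (at x)"
    by (intro ballI differentiable_mult differentiable_const differentiable_prod assms)
qed (simp add: finite_permutations)

section \<open>The Levi-Civita connection of a metric in a chart\<close>

lemma bilinear_linear:
  assumes "bilinear T"
  shows "linear (T a)" "linear (\<lambda>a. T a b)"
  using assms by (auto simp: bilinear_def)

text \<open>The coordinate form of a Riemannian metric. Local geometry is developed here free of
  manifolds and enters through \<open>metric_on_chart\<close>.\<close>

locale metric_on =
  fixes S :: "(real^'n::finite) set" and G :: "real^'n \<Rightarrow> real^'n \<Rightarrow> real^'n \<Rightarrow> real"
  assumes open_S: "open S"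
    and bilinear_metric: "x \<in> S \<Longrightarrow> bilinear (G x)"
    and metric_sym: "x \<in> S \<Longrightarrow> G x u v = G x v u"
    and metric_pos: "x \<in> S \<Longrightarrow> u \<noteq> 0 \<Longrightarrow> G x u u > 0"
    and smooth_metric: "smooth_on S (\<lambda>x. G x u v)"
begin

lemma metric_differentiable: "x \<in> S \<Longrightarrow> (\<lambda>y. G y u v) differentiable (at x)"
  using smooth_on_differentiable smooth_metric by blast

lemma metric_ddir_differentiable: "x \<in> S \<Longrightarrow> (\<lambda>y. ddir (\<lambda>z. G z u v) y w) differentiable (at x)"
  using smooth_on_differentiable smooth_on_ddir smooth_metric by blast

lemmas metric_simps =
  bilinear_ladd[OF bilinear_metric] bilinear_radd[OF bilinear_metric]
  bilinear_lsub[OF bilinear_metric] bilinear_rsub[OF bilinear_metric]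
  bilinear_lmul[OF bilinear_metric] bilinear_rmul[OF bilinear_metric]
  bilinear_lzero[OF bilinear_metric] bilinear_rzero[OF bilinear_metric]

lemma metric_eqI: "x \<in> S \<Longrightarrow> (\<And>w. G x u w = G x v w) \<Longrightarrow> u = v"
  using metric_pos[of x "u - v"] metric_simps(3)[of x u v "u - v"] by fastforce

definition metric_ddir :: "real^'n \<Rightarrow> real^'n \<Rightarrow> real^'n \<Rightarrow> real^'n \<Rightarrow> real"
  where "metric_ddir x u v w = ddir (\<lambda>y. G y v w) x u"

lemma metric_ddir_sym: "x \<in> S \<Longrightarrow> metric_ddir x u v w = metric_ddir x u w v"
  unfolding metric_ddir_def
  using ddir_cong_open[OF open_S, of x "\<lambda>y. G y v w" "\<lambda>y. G y w v"] metric_sym metric_differentiable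
  by auto

lemma linear_metric_ddir1: "x \<in> S \<Longrightarrow> linear (\<lambda>u. metric_ddir x u v w)"
  unfolding metric_ddir_def by (rule linear_ddir[OF metric_differentiable])

lemma linear_metric_ddir2:
  assumes "x \<in> S"
  shows "linear (\<lambda>v. metric_ddir x u v w)"
proof (rule linearI)
  fix v v' :: "real^'n" and r :: real
  have "((\<lambda>y. G y v w + G y v' w) has_derivative (\<lambda>h. ddir (\<lambda>y. G y v w) x h + ddir (\<lambda>y. G y v' w) x h)) (at x)"
    by (intro has_derivative_add has_derivative_ddir metric_differentiable assms)
  then have "((\<lambda>y. G y (v + v') w) has_derivative (\<lambda>h. ddir (\<lambda>y. G y v w) x h + ddir (\<lambda>y. G y v' w) x h)) (at x)"
    by (rule has_derivative_transform_within_open[OF _ open_S assms]) (simp add: metric_simps)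
  then show "metric_ddir x u (v + v') w = metric_ddir x u v w + metric_ddir x u v' w"
    by (simp add: metric_ddir_def ddir_has_derivative)
  have "((\<lambda>y. r * G y v w) has_derivative (\<lambda>h. r * ddir (\<lambda>y. G y v w) x h)) (at x)"
    by (intro has_derivative_mult_right has_derivative_ddir metric_differentiable assms)
  then have "((\<lambda>y. G y (r *\<^sub>R v) w) has_derivative (\<lambda>h. r * ddir (\<lambda>y. G y v w) x h)) (at x)"
    by (rule has_derivative_transform_within_open[OF _ open_S assms]) (simp add: metric_simps)
  then show "metric_ddir x u (r *\<^sub>R v) w = r *\<^sub>R metric_ddir x u v w"
    by (simp add: metric_ddir_def ddir_has_derivative)
qed

lemma linear_metric_ddir3: "x \<in> S \<Longrightarrow> linear (\<lambda>w. metric_ddir x u v w)"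
  using linear_metric_ddir2[of x u v] by (simp add: metric_ddir_sym[of x u v])

lemmas metric_ddir_simps =
  linear_add[OF linear_metric_ddir1] linear_cmul[OF linear_metric_ddir1]
  linear_add[OF linear_metric_ddir2] linear_cmul[OF linear_metric_ddir2]
  linear_add[OF linear_metric_ddir3] linear_cmul[OF linear_metric_ddir3]

text \<open>The Christoffel symbol of the first kind: the metric product with \<open>w\<close> of
  the covariant derivative of the constant field \<open>v\<close> in direction \<open>u\<close>.
  Being scalar and explicit in the metric, it is easier to differentiate than
  \<open>christoffel\<close>.\<close>

definition koszul :: "real^'n \<Rightarrow> real^'n \<Rightarrow> real^'n \<Rightarrow> real^'n \<Rightarrow> real"
  where "koszul x u v w = (metric_ddir x u v w + metric_ddir x v u w - metric_ddir x w u v) / 2"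

lemma linear_koszul1: "x \<in> S \<Longrightarrow> linear (\<lambda>u. koszul x u v w)"
  by (rule linearI) (simp_all add: koszul_def metric_ddir_simps algebra_simps add_divide_distrib diff_divide_distrib)

lemma koszul_sym: "x \<in> S \<Longrightarrow> koszul x u v w = koszul x v u w"
  by (simp add: koszul_def metric_ddir_sym[of x w u v])

lemma linear_koszul3: "x \<in> S \<Longrightarrow> linear (\<lambda>w. koszul x u v w)"
  by (rule linearI) (simp_all add: koszul_def metric_ddir_simps algebra_simps add_divide_distrib diff_divide_distrib)

lemma koszul_differentiable: "x \<in> S \<Longrightarrow> (\<lambda>y. koszul y u v w) differentiable (at x)"
  unfolding koszul_def metric_ddir_def divide_inverse
  by (intro differentiable_mult differentiable_diff differentiable_add
      metric_ddir_differentiable differentiable_const)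

text \<open>The Christoffel symbols solve a linear system whose matrix is the Gram matrix of the metric;
  Cramer's rule gives their existence and differentiability at once.\<close>

definition gram :: "real^'n \<Rightarrow> real^'n^'n"
  where "gram x = (\<chi> j i. G x (axis i 1) (axis j 1))"

definition cramer_christoffel :: "real^'n \<Rightarrow> real^'n \<Rightarrow> real^'n \<Rightarrow> real^'n"
  where "cramer_christoffel x u v =
    (\<chi> k. det (\<chi> i j. if j = k then koszul x u v (axis i 1) else gram x $ i $ j) / det (gram x))"

lemma linear_eq_axis:
  fixes f g :: "real^'n \<Rightarrow> real"
  assumes "linear f" "linear g" "\<And>j. f (axis j 1) = g (axis j 1)"
  shows "f w = g w"
proof -
  have "f = g"
    by (rule linear_eq_stdbasis[OF assms(1,2)]) (auto simp: Basis_vec_def assms(3))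
  then show ?thesis by simp
qed

lemma gram_mult: "x \<in> S \<Longrightarrow> (gram x *v z) $ j = G x z (axis j 1)"
proof -
  assume x: "x \<in> S"
  note l = bilinear_linear(2)[OF bilinear_metric[OF x], of "axis j 1"]
  have "G x z (axis j 1) = G x (\<Sum>i\<in>UNIV. (z $ i) *\<^sub>R axis i 1) (axis j 1)"
    using basis_expansion[of z] by (simp add: scalar_mult_eq_scaleR)
  also have "\<dots> = (\<Sum>i\<in>UNIV. z $ i * G x (axis i 1) (axis j 1))"
    by (simp add: linear_sum[OF l] linear_cmul[OF l])
  finally show ?thesis by (simp add: gram_def matrix_vector_mult_def mult.commute)
qed

text \<open>A vector in the kernel of the Gram matrix is metrically orthogonal to every coordinate
  axis, hence to everything, and a definite metric leaves only 0.\<close>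

lemma det_gram: "x \<in> S \<Longrightarrow> det (gram x) \<noteq> 0"
proof -
  assume x: "x \<in> S"
  have "z = 0" if "gram x *v z = 0" for z
  proof (rule metric_eqI[OF x])
    show "G x z w = G x 0 w" for w
      using linear_eq_axis[OF bilinear_linear(1)[OF bilinear_metric[OF x], of z]
          bilinear_linear(1)[OF bilinear_metric[OF x], of 0]]
        gram_mult[OF x, of z] that by (simp add: metric_simps x)
  qed
  then have "invertible (gram x)"
    by (simp add: invertible_left_inverse matrix_left_invertible_ker)
  then show ?thesis by (simp add: invertible_det_nz)
qed

text \<open>Both sides are linear in \<open>w\<close>, so testing on the axes suffices, and this is
  the Gram system. The equivalence gives existence and uniqueness together, as the THE in
  \<open>christoffel\<close> requires.\<close>

lemma koszul_iff_cramer: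
  assumes x: "x \<in> S"
  shows "(\<forall>w. G x z w = koszul x u v w) \<longleftrightarrow> z = cramer_christoffel x u v"
proof -
  have "(\<forall>w. G x z w = koszul x u v w) \<longleftrightarrow> (\<forall>j. G x z (axis j 1) = koszul x u v (axis j 1))"
    using linear_eq_axis[OF bilinear_linear(1)[OF bilinear_metric[OF x], of z] linear_koszul3[OF x]]
    by blast
  also have "\<dots> \<longleftrightarrow> gram x *v z = (\<chi> j. koszul x u v (axis j 1))"
    by (simp add: vec_eq_iff gram_mult[OF x])
  also have "\<dots> \<longleftrightarrow> z = cramer_christoffel x u v"
    unfolding cramer[OF det_gram[OF x]] cramer_christoffel_def vec_lambda_beta ..
  finally show ?thesis .
qed

lemma christoffel_eq_cramer:
  assumes x: "x \<in> S"
  shows "christoffel G x u v = cramer_christoffel x u v"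
proof -
  have "(\<forall>w. 2 * G x z w = ddir (\<lambda>y. G y v w) x u + ddir (\<lambda>y. G y u w) x v - ddir (\<lambda>y. G y u v) x w)
      \<longleftrightarrow> z = cramer_christoffel x u v" for z
    unfolding koszul_iff_cramer[OF x, symmetric] koszul_def metric_ddir_def
    by (rule iff_allI) (auto simp: field_simps)
  then show ?thesis unfolding christoffel_def by simp
qed

lemma metric_christoffel: "x \<in> S \<Longrightarrow> G x (christoffel G x u v) w = koszul x u v w"
  using koszul_iff_cramer christoffel_eq_cramer by blast

text \<open>Agreement with Cramer's formula is known only on \<open>S\<close>; openness of
  \<open>S\<close> transfers differentiability. The formula is rational in the metric and its first
  derivatives, with nonvanishing denominator.\<close>

lemma christoffel_differentiable:
  assumes x: "x \<in> S"
  shows "(\<lambda>y. christoffel G y u v) differentiable (at x)"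
proof (rule differentiable_cong_open[OF open_S x])
  show "cramer_christoffel y u v = christoffel G y u v" if "y \<in> S" for y
    using christoffel_eq_cramer[OF that] by simp
  have g: "(\<lambda>y. gram y $ i $ j) differentiable (at x)" for i j
    unfolding gram_def using metric_differentiable[OF x] by simp
  have "(\<lambda>y. cramer_christoffel y u v $ k) differentiable (at x)" for k
    unfolding cramer_christoffel_def vec_lambda_beta
  proof (intro differentiable_divide differentiable_det)
    show "(\<lambda>y. (\<chi> i j. if j = k then koszul y u v (axis i 1) else gram y $ i $ j) $ i $ j) differentiable (at x)"
      for i j
      using g koszul_differentiable[OF x] by (cases "j = k") simp_all
  qed (use g det_gram[OF x] in auto)
  then show "(\<lambda>y. cramer_christoffel y u v) differentiable (at x)"
    by (subst differentiable_componentwise_within) (auto simp: Basis_vec_def inner_axis)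
qed

lemma christoffel_sym:
  assumes x: "x \<in> S"
  shows "christoffel G x u v = christoffel G x v u"
  by (rule metric_eqI[OF x]) (simp add: metric_christoffel[OF x] koszul_sym[OF x, of u v])

lemma bilinear_christoffel:
  assumes x: "x \<in> S"
  shows "bilinear (christoffel G x)"
proof -
  have "linear (\<lambda>u. christoffel G x u v)" for v
    by (rule linearI; rule metric_eqI[OF x])
      (simp_all add: metric_christoffel metric_simps x linear_add[OF linear_koszul1] linear_cmul[OF linear_koszul1])
  moreover from this have "linear (christoffel G x u)" for u
    using christoffel_sym[OF x, of u] by presburger
  ultimately show ?thesis unfolding bilinear_def by blast
qed

text \<open>In \<open>koszul x u v w + koszul x u w v\<close> the derivatives in directions
  \<open>v\<close> and \<open>w\<close> cancel, leaving the derivative of the metric in direction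
  \<open>u\<close>.\<close>

lemma metric_compatible:
  assumes x: "x \<in> S"
  shows "ddir (\<lambda>y. G y v w) x u = G x (christoffel G x u v) w + G x v (christoffel G x u w)"
  using metric_sym[OF x, of v "christoffel G x u w"]
  by (simp add: metric_christoffel x koszul_def metric_ddir_def[symmetric] field_simps
      metric_ddir_sym[OF x, of w u v] metric_ddir_sym[OF x, of u v w] metric_ddir_sym[OF x, of v u w])

lemma ddir_metric_product:
  assumes x: "x \<in> S" and X: "X differentiable (at x)" and Y: "Y differentiable (at x)"
  shows "ddir (\<lambda>y. G y (X y) (Y y)) x u =
    G x (ddir X x u + christoffel G x u (X x)) (Y x) + G x (X x) (ddir Y x u + christoffel G x u (Y x))"
proof -
  note ddir_has_derivative[OF has_derivative_bilinear_family[OF open_S x bilinear_metric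
    metric_differentiable[OF x] has_derivative_ddir[OF X] has_derivative_ddir[OF Y]]]
  then show ?thesis by (simp add: metric_compatible x metric_simps)
qed

text \<open>Differentiating \<open>G y (christoffel G y v w) z\<close>, which is
  \<open>koszul y v w z\<close>, by metric compatibility replaces derivatives of vectors by
  derivatives of scalars, at the cost of products of Christoffel vectors. Both the symmetry of
  sectional curvature and the Gauss equation start from this form.\<close>

lemma lowered_curvature:
  assumes x: "x \<in> S"
  shows "G x (chart_curvature G x u v w) z =
    ddir (\<lambda>y. koszul y v w z) x u - ddir (\<lambda>y. koszul y u w z) x v
    - G x (christoffel G x v w) (christoffel G x u z) + G x (christoffel G x u w) (christoffel G x v z)"
proof -
  have *: "ddir (\<lambda>y. koszul y v w z) x u = 
    G x (ddir (\<lambda>y. christoffel G y v w) x u + christoffel G x u (christoffel G x v w)) z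
    + G x (christoffel G x v w) (christoffel G x u z)" for u v
  proof -
    have "ddir (\<lambda>y. koszul y v w z) x u = ddir (\<lambda>y. G y (christoffel G y v w) z) x u"
      by (rule fun_cong[OF ddir_cong_open[OF open_S x metric_christoffel[symmetric] koszul_differentiable[OF x]]])
    also have "\<dots> = G x (ddir (\<lambda>y. christoffel G y v w) x u + christoffel G x u (christoffel G x v w)) z
      + G x (christoffel G x v w) (christoffel G x u z)"
      using ddir_metric_product[OF x christoffel_differentiable[OF x] differentiable_const, of v w z u]
      by (simp add: ddir_def)
    finally show ?thesis .
  qed
  show ?thesis unfolding * chart_curvature_def by (simp add: metric_simps x)
qed

text \<open>In lowered form only second derivatives \<open>D\<close> of the metric and products of
  Christoffel vectors occur. Commuting partial derivatives and the symmetry of the metric make the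
  sum invariant under exchanging \<open>u\<close> and \<open>v\<close>. This is what lets sums over
  unordered pairs become double sums.\<close>

lemma sectional_form_sym:
  assumes x: "x \<in> S"
  shows "G x (chart_curvature G x u v v) u = G x (chart_curvature G x v u u) v"
proof -
  let ?g = "\<lambda>u v y. G y u v"
  define D where "D a b c d = ddir (\<lambda>y. ddir (?g c d) y b) x a" for a b c d
  have Dc: "D a b c d = D b a c d" for a b c d
    unfolding D_def by (rule ddir_commute[OF smooth_metric open_S x])
  have gs: "ddir (?g c d) y b = ddir (?g d c) y b" if "y \<in> S" for y b c d
    using metric_ddir_sym[OF that, of b c d] unfolding metric_ddir_def .
  have Ds: "D a b c d = D a b d c" for a b c d
    unfolding D_def
    by (rule fun_cong[OF ddir_cong_open[OF open_S x gs metric_ddir_differentiable[OF x]]])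
  have k: "ddir (\<lambda>y. koszul y a b c) x d = (D d a b c + D d b a c - D d c a b) / 2" for a b c d
  proof -
    have "((\<lambda>y. koszul y a b c) has_derivative (\<lambda>d. (D d a b c + D d b a c - D d c a b) * inverse 2)) (at x)"
      unfolding koszul_def metric_ddir_def D_def divide_inverse
      by (intro has_derivative_mult_left has_derivative_diff has_derivative_add has_derivative_ddir
        metric_ddir_differentiable x)
    from ddir_has_derivative[OF this] show ?thesis by (simp only: divide_inverse)
  qed
  show ?thesis
    unfolding lowered_curvature[OF x] k Dc[of u v v u] Dc[of u v u v] Ds[of v u u v]
      metric_sym[OF x, of "christoffel G x v v" "christoffel G x u u"]
      metric_sym[OF x, of "christoffel G x u v" "christoffel G x v u"]
    by (simp add: diff_divide_distrib)
qed

lemma ddir_christoffel_bilinear: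
  assumes x: "x \<in> S"
  shows "bilinear (\<lambda>v w. ddir (\<lambda>y. christoffel G y v w) x u)"
proof -
  let ?C = "\<lambda>v w y. christoffel G y v w"
  have l: "linear (\<lambda>v. ddir (?C v w) x u)" for w
  proof (rule linearI)
    fix v v' :: "real^'n" and r :: real
    have "((\<lambda>y. ?C v w y + ?C v' w y) has_derivative (\<lambda>h. ddir (?C v w) x h + ddir (?C v' w) x h)) (at x)"
      by (intro has_derivative_add has_derivative_ddir christoffel_differentiable x)
    then have "(?C (v + v') w has_derivative (\<lambda>h. ddir (?C v w) x h + ddir (?C v' w) x h)) (at x)"
      by (rule has_derivative_transform_within_open[OF _ open_S x])
        (simp add: bilinear_ladd[OF bilinear_christoffel])
    then show "ddir (?C (v + v') w) x u = ddir (?C v w) x u + ddir (?C v' w) x u"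
      by (simp add: ddir_has_derivative)
    have "((\<lambda>y. r *\<^sub>R ?C v w y) has_derivative (\<lambda>h. r *\<^sub>R ddir (?C v w) x h)) (at x)"
      by (intro has_derivative_scaleR_right has_derivative_ddir christoffel_differentiable x)
    then have "(?C (r *\<^sub>R v) w has_derivative (\<lambda>h. r *\<^sub>R ddir (?C v w) x h)) (at x)"
      by (rule has_derivative_transform_within_open[OF _ open_S x])
        (simp add: bilinear_lmul[OF bilinear_christoffel])
    then show "ddir (?C (r *\<^sub>R v) w) x u = r *\<^sub>R ddir (?C v w) x u"
      by (simp add: ddir_has_derivative)
  qed
  have s: "ddir (?C v w) x u = ddir (?C w v) x u" for v w
    by (rule fun_cong[OF ddir_cong_open[OF open_S x christoffel_sym christoffel_differentiable[OF x]]])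
  have "linear (\<lambda>w. ddir (?C v w) x u)" for v
    unfolding s[of v] by (rule l)
  with l show ?thesis by (simp add: bilinear_def)
qed

lemma linear_chart_curvature:
  assumes x: "x \<in> S"
  shows "linear (\<lambda>u. chart_curvature G x u v w)" "linear (\<lambda>v. chart_curvature G x u v w)"
    "linear (\<lambda>w. chart_curvature G x u v w)"
proof -
  note cb = bilinear_ladd[OF bilinear_christoffel[OF x]] bilinear_radd[OF bilinear_christoffel[OF x]]
    bilinear_lmul[OF bilinear_christoffel[OF x]] bilinear_rmul[OF bilinear_christoffel[OF x]]
    bilinear_ladd[OF ddir_christoffel_bilinear[OF x]] bilinear_radd[OF ddir_christoffel_bilinear[OF x]]
    bilinear_lmul[OF ddir_christoffel_bilinear[OF x]] bilinear_rmul[OF ddir_christoffel_bilinear[OF x]]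
    linear_add[OF linear_ddir[OF christoffel_differentiable[OF x]]]
    linear_cmul[OF linear_ddir[OF christoffel_differentiable[OF x]]]
  show "linear (\<lambda>u. chart_curvature G x u v w)" "linear (\<lambda>v. chart_curvature G x u v w)"
    "linear (\<lambda>w. chart_curvature G x u v w)"
    by (rule linearI; simp add: chart_curvature_def cb algebra_simps)+
qed

end

section \<open>Isometric maps between coordinate domains and the Gauss equation\<close>

locale isometric_chart =
  domain: metric_on U g + target: metric_on V G
  for U :: "(real^'n::finite) set" and g and V :: "(real^'m::finite) set" and G +
  fixes F :: "real^'n \<Rightarrow> real^'m"
  assumes smooth_F: "smooth_on U F"
    and F_in: "x \<in> U \<Longrightarrow> F x \<in> V"
    and pullback: "x \<in> U \<Longrightarrow> g x u v = G (F x) (ddir F x u) (ddir F x v)"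
begin

abbreviation dF :: "real^'n \<Rightarrow> real^'n \<Rightarrow> real^'m"
  where "dF u x \<equiv> ddir F x u"

text \<open>\<open>cov u v\<close> is the covariant derivative along \<open>F\<close> of the field \<open>dF v\<close> in direction \<open>u\<close>, and
  \<open>sff\<close> its normal part.\<close>

definition cov :: "real^'n \<Rightarrow> real^'n \<Rightarrow> real^'n \<Rightarrow> real^'m"
  where "cov u v x = ddir (dF v) x u + christoffel G (F x) (dF u x) (dF v x)"

definition sff :: "real^'n \<Rightarrow> real^'n \<Rightarrow> real^'n \<Rightarrow> real^'m"
  where "sff x u v = cov u v x - ddir F x (christoffel g x u v)"

lemma F_differentiable: "x \<in> U \<Longrightarrow> F differentiable (at x)"
  using smooth_on_differentiable smooth_F by blast

lemma dF_differentiable: "x \<in> U \<Longrightarrow> dF v differentiable (at x)"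
  using smooth_on_differentiable smooth_on_ddir smooth_F by blast

lemma ddF_differentiable: "x \<in> U \<Longrightarrow> (\<lambda>y. ddir (dF v) y u) differentiable (at x)"
  using smooth_on_differentiable smooth_on_ddir smooth_F by blast

text \<open>Torsion-freeness along \<open>F\<close>: second derivatives of \<open>F\<close> commute
  and the Christoffel symbols are symmetric.\<close>

lemma cov_sym: "x \<in> U \<Longrightarrow> cov u v x = cov v u x"
  unfolding cov_def using ddir_commute[OF smooth_F domain.open_S] target.christoffel_sym[OF F_in]
  by metis

text \<open>Chain and product rule for a bilinear object living on the target: the base point moves
  with velocity \<open>dF u x\<close> while both arguments vary. It is applied to \<open>G\<close>
  and to \<open>christoffel G\<close>.\<close>

lemma ddir_along_F:
  fixes T :: "real^'m \<Rightarrow> real^'m \<Rightarrow> real^'m \<Rightarrow> 'c::real_normed_vector"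
  assumes x: "x \<in> U" and bil: "\<And>y. y \<in> V \<Longrightarrow> bilinear (T y)"
    and T: "\<And>y a b. y \<in> V \<Longrightarrow> (\<lambda>y. T y a b) differentiable (at y)"
    and X: "X differentiable (at x)" and Y: "Y differentiable (at x)"
  shows "(\<lambda>y. T (F y) (X y) (Y y)) differentiable (at x)"
    "ddir (\<lambda>y. T (F y) (X y) (Y y)) x u =
      ddir (\<lambda>z. T z (X x) (Y x)) (F x) (dF u x) + T (F x) (ddir X x u) (Y x) + T (F x) (X x) (ddir Y x u)"
proof -
  have d: "(\<lambda>y. T (F y) a b) differentiable (at x)" for a b
    using differentiable_chain_at[OF F_differentiable[OF x] T[OF F_in[OF x]], of a b] by (simp add: o_def)
  note h = has_derivative_bilinear_family[OF domain.open_S x _ d has_derivative_ddir[OF X]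
      has_derivative_ddir[OF Y], OF bil[OF F_in]]
  show "(\<lambda>y. T (F y) (X y) (Y y)) differentiable (at x)"
    using h differentiable_def by blast
  have "ddir (\<lambda>y. T (F y) (X x) (Y x)) x u = ddir (\<lambda>z. T z (X x) (Y x)) (F x) (dF u x)"
    using ddir_compose[OF F_differentiable[OF x] T[OF F_in[OF x]], of "X x" "Y x"] by (simp add: o_def)
  then show "ddir (\<lambda>y. T (F y) (X y) (Y y)) x u =
      ddir (\<lambda>z. T z (X x) (Y x)) (F x) (dF u x) + T (F x) (ddir X x u) (Y x) + T (F x) (X x) (ddir Y x u)"
    using ddir_has_derivative[OF h] by simp
qed

lemma ddir_metric_along_F:
  assumes x: "x \<in> U" and X: "X differentiable (at x)" and Y: "Y differentiable (at x)"
  shows "ddir (\<lambda>y. G (F y) (X y) (Y y)) x u =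
    G (F x) (ddir X x u + christoffel G (F x) (dF u x) (X x)) (Y x) +
    G (F x) (X x) (ddir Y x u + christoffel G (F x) (dF u x) (Y x))"
  using ddir_along_F(2)[OF x target.bilinear_metric target.metric_differentiable X Y, of u]
  by (simp add: target.metric_compatible F_in x target.metric_simps)

lemma cov_differentiable: "x \<in> U \<Longrightarrow> cov u v differentiable (at x)"
  unfolding cov_def[abs_def]
  by (intro differentiable_add ddF_differentiable
      ddir_along_F(1)[OF _ target.bilinear_christoffel target.christoffel_differentiable]
      dF_differentiable)

lemma ddir_cov:
  assumes x: "x \<in> U"
  shows "ddir (cov v w) x u = ddir (\<lambda>y. ddir (dF w) y v) x u
    + (ddir (\<lambda>z. christoffel G z (dF v x) (dF w x)) (F x) (dF u x)
       + christoffel G (F x) (ddir (dF v) x u) (dF w x) + christoffel G (F x) (dF v x) (ddir (dF w) x u))"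
proof -
  have "(cov v w has_derivative (\<lambda>u. ddir (\<lambda>y. ddir (dF w) y v) x u + 
      ddir (\<lambda>y. christoffel G (F y) (dF v y) (dF w y)) x u)) (at x)"
    unfolding cov_def[abs_def]
    by (intro has_derivative_add has_derivative_ddir ddF_differentiable x dF_differentiable
      ddir_along_F(1)[OF _ target.bilinear_christoffel target.christoffel_differentiable])
  then show ?thesis
    using ddir_along_F(2)[OF x target.bilinear_christoffel target.christoffel_differentiable
        dF_differentiable[OF x] dF_differentiable[OF x], of v w u]
    by (simp add: ddir_has_derivative)
qed

text \<open>\<open>cov\<close> is torsion-free and compatible with the metric along
  \<open>F\<close>, so the Koszul argument applies to it. Hence its tangential part is the
  Levi-Civita connection of the induced metric, and \<open>sff\<close> is normal.\<close>

lemma metric_cov: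
  assumes x: "x \<in> U"
  shows "G (F x) (cov u v x) (dF w x) = domain.koszul x u v w"
proof -
  have d: "domain.metric_ddir x a b c = G (F x) (cov a b x) (dF c x) + G (F x) (dF b x) (cov a c x)" for a b c
  proof -
    have "domain.metric_ddir x a b c = ddir (\<lambda>y. G (F y) (dF b y) (dF c y)) x a"
      unfolding domain.metric_ddir_def
      by (rule fun_cong[OF ddir_cong_open[OF domain.open_S x pullback domain.metric_differentiable[OF x]]])
    also have "\<dots> = G (F x) (cov a b x) (dF c x) + G (F x) (dF b x) (cov a c x)"
      using ddir_metric_along_F[OF x dF_differentiable[OF x] dF_differentiable[OF x]]
      by (simp add: cov_def)
    finally show ?thesis .
  qed
  show ?thesis
    unfolding domain.koszul_def d
    using target.metric_sym[OF F_in[OF x]] cov_sym[OF x] by (simp add: field_simps)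
qed

lemma metric_cov_christoffel:
  "x \<in> U \<Longrightarrow> G (F x) (cov u v x) (dF w x) = g x (christoffel g x u v) w"
  by (simp add: metric_cov domain.metric_christoffel)

text \<open>Pythagoras: normal and tangential parts are orthogonal, so the product of the
  \<open>cov\<close> vectors splits, and the tangential share is a product in the induced
  metric.\<close>

lemma metric_sff:
  assumes x: "x \<in> U"
  shows "G (F x) (sff x u v) (sff x w z) = G (F x) (cov u v x) (cov w z x) - g x (christoffel g x u v) (christoffel g x w z)"
  unfolding sff_def
  by (simp add: target.metric_simps F_in x metric_cov_christoffel pullback[OF x, symmetric]
      target.metric_sym[OF F_in[OF x], of "ddir F x a" "cov w z x" for a] domain.metric_sym[OF x, of "christoffel g x w z"])

text \<open>The second computation of this derivative, now through the target. The first, through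
  the domain metric, is contained in \<open>lowered_curvature\<close>.\<close>

lemma ddir_koszul:
  assumes x: "x \<in> U"
  shows "ddir (\<lambda>y. domain.koszul y v w z) x u =
    G (F x) (ddir (cov v w) x u + christoffel G (F x) (dF u x) (cov v w x)) (dF z x)
    + G (F x) (cov v w x) (cov u z x)"
proof -
  have "ddir (\<lambda>y. domain.koszul y v w z) x u = ddir (\<lambda>y. G (F y) (cov v w y) (dF z y)) x u"
    by (rule fun_cong[OF ddir_cong_open[OF domain.open_S x metric_cov[symmetric] domain.koszul_differentiable[OF x]]])
  also have "\<dots> = G (F x) (ddir (cov v w) x u + christoffel G (F x) (dF u x) (cov v w x)) (dF z x)
    + G (F x) (cov v w x) (cov u z x)"
    using ddir_metric_along_F[OF x cov_differentiable[OF x] dF_differentiable[OF x]]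
    by (simp add: cov_def)
  finally show ?thesis .
qed

text \<open>Antisymmetrising in \<open>u\<close> and \<open>v\<close> cancels the third derivatives
  of \<open>F\<close> and the terms with its mixed second derivatives; what remains is exactly the
  curvature expression of the target.\<close>

lemma curvature_along_F:
  assumes x: "x \<in> U"
  shows "ddir (cov v w) x u + christoffel G (F x) (dF u x) (cov v w x)
     - (ddir (cov u w) x v + christoffel G (F x) (dF v x) (cov u w x))
     = chart_curvature G (F x) (dF u x) (dF v x) (dF w x)"
proof -
  have c3: "ddir (\<lambda>y. ddir (dF w) y v) x u = ddir (\<lambda>y. ddir (dF w) y u) x v"
    by (rule ddir_commute[OF smooth_on_ddir[OF smooth_F] domain.open_S x])
  have c2: "ddir (dF v) x u = ddir (dF u) x v"
    by (rule ddir_commute[OF smooth_F domain.open_S x])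
  show ?thesis
    unfolding ddir_cov[OF x] chart_curvature_def c3 c2 cov_def
    by (simp add: bilinear_radd[OF target.bilinear_christoffel[OF F_in[OF x]]] algebra_simps)
qed

text \<open>Substituting \<open>ddir_koszul\<close> into \<open>lowered_curvature\<close>, the
  derivative terms combine to the ambient curvature, and each product of \<open>cov\<close> vectors
  minus the corresponding product of domain Christoffel vectors is a product of \<open>sff\<close>
  terms.\<close>

theorem gauss_equation:
  assumes x: "x \<in> U"
  shows "g x (chart_curvature g x u v w) z =
    G (F x) (chart_curvature G (F x) (dF u x) (dF v x) (dF w x)) (dF z x)
    + G (F x) (sff x v w) (sff x u z) - G (F x) (sff x u w) (sff x v z)"
  unfolding domain.lowered_curvature[OF x] ddir_koszul[OF x] metric_sff[OF x] curvature_along_F[OF x, symmetric]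
  by (simp add: target.metric_simps F_in x)

lemma sff_sym: "x \<in> U \<Longrightarrow> sff x u v = sff x v u"
  by (simp add: sff_def cov_sym[of x u v] domain.christoffel_sym[of x u v])

lemma bilinear_sff:
  assumes x: "x \<in> U"
  shows "bilinear (sff x)"
proof -
  have l: "linear (\<lambda>u. sff x u v)" for v
    unfolding sff_def cov_def
    by (rule linearI)
      (simp_all add: linear_add[OF linear_ddir[OF dF_differentiable[OF x]]] 
        linear_cmul[OF linear_ddir[OF dF_differentiable[OF x]]]
        linear_add[OF linear_ddir[OF F_differentiable[OF x]]] 
        linear_cmul[OF linear_ddir[OF F_differentiable[OF x]]]
        bilinear_ladd[OF target.bilinear_christoffel[OF F_in[OF x]]]
        bilinear_lmul[OF target.bilinear_christoffel[OF F_in[OF x]]]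
        bilinear_ladd[OF domain.bilinear_christoffel[OF x]]
        bilinear_lmul[OF domain.bilinear_christoffel[OF x]] algebra_simps)
  have "linear (\<lambda>v. sff x u v)" for u
    unfolding sff_sym[OF x, of u] by (rule l)
  with l show ?thesis by (simp add: bilinear_def)
qed

end

section \<open>Orthonormal sets and traces\<close>

text \<open>The metric at a single point: an inner product unrelated to the built-in one, so
  orthonormal expansion and Gram-Schmidt are carried out for \<open>g\<close> itself.\<close>

locale inner_form =
  fixes g :: "'v::euclidean_space \<Rightarrow> 'v \<Rightarrow> real"
  assumes bilinear_form: "bilinear g"
    and form_sym: "g u v = g v u"
    and form_pos: "u \<noteq> 0 \<Longrightarrow> g u u > 0"
begin

lemmas form_simps =
  bilinear_ladd[OF bilinear_form] bilinear_radd[OF bilinear_form]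
  bilinear_lsub[OF bilinear_form] bilinear_rsub[OF bilinear_form]
  bilinear_lmul[OF bilinear_form] bilinear_rmul[OF bilinear_form]
  bilinear_lzero[OF bilinear_form] bilinear_rzero[OF bilinear_form]
  linear_sum[OF bilinear_linear(1)[OF bilinear_form]]
  linear_sum[OF bilinear_linear(2)[OF bilinear_form]]

definition orthonormal :: "'v set \<Rightarrow> bool"
  where "orthonormal S \<longleftrightarrow> finite S \<and> (\<forall>a\<in>S. \<forall>b\<in>S. g a b = (if a = b then 1 else 0))"

lemma orthonormal_empty: "orthonormal {}"
  by (simp add: orthonormal_def)

lemma orthonormal_subset: "orthonormal S \<Longrightarrow> T \<subseteq> S \<Longrightarrow> orthonormal T"
  unfolding orthonormal_def using finite_subset by blast

lemma orthonormal_expand: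
  assumes "orthonormal S" "v \<in> span S"
  shows "v = (\<Sum>a\<in>S. g v a *\<^sub>R a)"
  using assms(2)
proof (induction rule: span_induct)
  case base
  show ?case
  proof (rule subspaceI)
    fix c x assume "x \<in> {v. v = (\<Sum>a\<in>S. g v a *\<^sub>R a)}"
    then have "c *\<^sub>R x = c *\<^sub>R (\<Sum>a\<in>S. g x a *\<^sub>R a)" by simp
    also have "\<dots> = (\<Sum>a\<in>S. g (c *\<^sub>R x) a *\<^sub>R a)"
      by (simp add: form_simps(5) scaleR_sum_right)
    finally show "c *\<^sub>R x \<in> {v. v = (\<Sum>a\<in>S. g v a *\<^sub>R a)}" by simp
  next
    fix x y assume "x \<in> {v. v = (\<Sum>a\<in>S. g v a *\<^sub>R a)}" "y \<in> {v. v = (\<Sum>a\<in>S. g v a *\<^sub>R a)}"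
    then have "x + y = (\<Sum>a\<in>S. g x a *\<^sub>R a) + (\<Sum>a\<in>S. g y a *\<^sub>R a)" by simp
    also have "\<dots> = (\<Sum>a\<in>S. g (x + y) a *\<^sub>R a)"
      by (simp add: form_simps(1) scaleR_add_left sum.distrib)
    finally show "x + y \<in> {v. v = (\<Sum>a\<in>S. g v a *\<^sub>R a)}" by simp
  qed (simp add: form_simps(7))
next
  case (step x)
  have "(\<Sum>a\<in>S. g x a *\<^sub>R a) = (\<Sum>a\<in>S. if a = x then x else 0)"
    using assms(1) step by (intro sum.cong) (auto simp: orthonormal_def)
  also have "\<dots> = x" using assms(1) step by (simp add: orthonormal_def)
  finally show ?case by simp
qed

lemma orthonormal_independent:
  assumes "orthonormal S"
  shows "independent S"
proof
  assume "dependent S"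
  then obtain a where a: "a \<in> S" "a \<in> span (S - {a})" unfolding dependent_def by blast
  have "a = (\<Sum>b\<in>S - {a}. g a b *\<^sub>R b)"
    by (rule orthonormal_expand[OF orthonormal_subset[OF assms] a(2)]) auto
  also have "\<dots> = 0"
    using assms a(1) by (intro sum.neutral) (auto simp: orthonormal_def)
  finally have "g a a = 0" by (simp add: form_simps)
  moreover have "g a a = 1" using assms a(1) by (simp add: orthonormal_def)
  ultimately show False by simp
qed

text \<open>One Gram-Schmidt step: \<open>s\<close> is the orthogonal projection of \<open>x\<close>
  to \<open>span S\<close>, and the remainder \<open>z\<close> is normalised.\<close>

lemma orthonormal_extend_one:
  assumes S: "orthonormal S" and L: "subspace L" "S \<subseteq> L" and "span S \<noteq> L"
  shows "\<exists>y\<in>L. y \<notin> S \<and> orthonormal (insert y S)"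
proof -
  have "span S \<subseteq> L" using L by (simp add: span_minimal)
  then obtain x where x: "x \<in> L" "x \<notin> span S" using assms(4) by blast
  have fin: "finite S" using S by (simp add: orthonormal_def)
  define s where "s = (\<Sum>a\<in>S. g x a *\<^sub>R a)"
  define z where "z = x - s"
  define y where "y = (1 / sqrt (g z z)) *\<^sub>R z"
  have s: "s \<in> span S" unfolding s_def by (intro span_sum span_scale span_base)
  then have "z \<noteq> 0" using x by (auto simp: z_def)
  then have pos: "g z z > 0" by (rule form_pos)
  have "g z b = 0" if b: "b \<in> S" for b
  proof -
    have "g s b = (\<Sum>a\<in>S. if a = b then g x b else 0)"
      unfolding s_def form_simps using S b by (intro sum.cong) (auto simp: orthonormal_def)
    also have "\<dots> = g x b" using fin b by simp
    finally show ?thesis by (simp add: z_def form_simps)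
  qed
  then have yb: "g y b = 0" "g b y = 0" if "b \<in> S" for b
    using that form_sym[of b y] by (simp_all add: y_def form_simps)
  have yy: "g y y = 1"
    using pos by (simp add: y_def form_simps field_simps)
  have "y \<notin> S" using yb yy by force
  moreover have "y \<in> L"
    using x s \<open>span S \<subseteq> L\<close> L(1) by (auto simp: y_def z_def intro!: subspace_scale subspace_diff)
  moreover have "orthonormal (insert y S)"
    using S yb yy fin by (auto simp: orthonormal_def)
  ultimately show ?thesis by blast
qed

text \<open>Orthonormal sets are independent, so their cardinality is bounded by the dimension and
  the Gram-Schmidt steps terminate. Starting from the empty set gives bases of subspaces; starting
  from a union of such bases gives an adapted basis.\<close>

lemma orthonormal_extend:
  assumes "orthonormal S" "subspace L" "S \<subseteq> L"
  shows "\<exists>T. S \<subseteq> T \<and> orthonormal T \<and> span T = L"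
  using assms
proof (induction "DIM('v) - card S" arbitrary: S rule: less_induct)
  case less
  show ?case
  proof (cases "span S = L")
    case False
    then obtain y where y: "y \<in> L" "y \<notin> S" "orthonormal (insert y S)"
      using orthonormal_extend_one less.prems by blast
    have "card (insert y S) \<le> DIM('v)"
      using independent_card_le_dim[of "insert y S" UNIV] orthonormal_independent[OF y(3)] by simp
    moreover have "card (insert y S) = Suc (card S)"
      using y less.prems by (simp add: orthonormal_def)
    ultimately have "DIM('v) - card (insert y S) < DIM('v) - card S" by simp
    from less.hyps[OF this y(3) less.prems(2)] y(1) less.prems(3) show ?thesis by auto
  qed (use less.prems in blast)
qed

text \<open>Expanding each \<open>a\<close> in \<open>T\<close> and summing over \<open>S\<close>,
  Parseval turns the coefficient of \<open>\<beta> b c\<close> into \<open>g b c\<close>. The values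
  are vectors because \<open>\<beta>\<close> will also be the second fundamental form.\<close>

lemma trace_basis_independent:
  fixes \<beta> :: "'v \<Rightarrow> 'v \<Rightarrow> 'w::real_vector"
  assumes S: "orthonormal S" and T: "orthonormal T" and eq: "span S = span T" and \<beta>: "bilinear \<beta>"
  shows "(\<Sum>a\<in>S. \<beta> a a) = (\<Sum>b\<in>T. \<beta> b b)"
proof -
  note l = bilinear_linear[OF \<beta>]
  have parseval: "(\<Sum>a\<in>S. g a b * g a c) = g b c" if "b \<in> span S" for b c
  proof -
    have "g b c = g (\<Sum>a\<in>S. g b a *\<^sub>R a) c" using orthonormal_expand[OF S that] by simp
    also have "\<dots> = (\<Sum>a\<in>S. g a b * g a c)" by (simp add: form_simps form_sym[of b])
    finally show ?thesis by simp
  qed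
  have "(\<Sum>a\<in>S. \<beta> a a) = (\<Sum>a\<in>S. \<Sum>b\<in>T. \<Sum>c\<in>T. (g a b * g a c) *\<^sub>R \<beta> b c)"
  proof (intro sum.cong refl)
    fix a assume "a \<in> S"
    then have a: "a = (\<Sum>b\<in>T. g a b *\<^sub>R b)"
      using orthonormal_expand[OF T] eq span_base[of a S] by simp
    have "\<beta> a a = \<beta> (\<Sum>b\<in>T. g a b *\<^sub>R b) (\<Sum>c\<in>T. g a c *\<^sub>R c)" using a by simp
    also have "\<dots> = (\<Sum>b\<in>T. \<Sum>c\<in>T. (g a b * g a c) *\<^sub>R \<beta> b c)"
      by (subst linear_sum[OF l(2)])
        (simp add: linear_cmul[OF l(2)] linear_sum[OF l(1)] linear_cmul[OF l(1)] scaleR_sum_right mult.commute)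
    finally show "\<beta> a a = (\<Sum>b\<in>T. \<Sum>c\<in>T. (g a b * g a c) *\<^sub>R \<beta> b c)" .
  qed
  also have "\<dots> = (\<Sum>b\<in>T. \<Sum>c\<in>T. \<Sum>a\<in>S. (g a b * g a c) *\<^sub>R \<beta> b c)"
    by (rule trans[OF sum.swap]) (rule sum.cong[OF refl sum.swap])
  also have "\<dots> = (\<Sum>b\<in>T. \<Sum>c\<in>T. if c = b then \<beta> b b else 0)"
  proof (intro sum.cong refl)
    fix b c assume "b \<in> T" "c \<in> T"
    then show "(\<Sum>a\<in>S. (g a b * g a c) *\<^sub>R \<beta> b c) = (if c = b then \<beta> b b else 0)"
      using parseval[of b c] T eq span_base[of b T]
      by (auto simp: scaleR_sum_left[symmetric] orthonormal_def)
  qed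
  also have "\<dots> = (\<Sum>b\<in>T. \<beta> b b)" using T by (simp add: orthonormal_def)
  finally show ?thesis .
qed

text \<open>The expression is a trace in \<open>a\<close> and a trace in \<open>b\<close>, so the
  basis can be changed in one index at a time.\<close>

lemma double_trace_basis_independent:
  fixes R :: "'v \<Rightarrow> 'v \<Rightarrow> 'v \<Rightarrow> 'v"
  assumes S: "orthonormal S" and T: "orthonormal T" and eq: "span S = span T"
    and R: "\<And>v w. linear (\<lambda>u. R u v w)" "\<And>u w. linear (\<lambda>v. R u v w)" "\<And>u v. linear (R u v)"
  shows "(\<Sum>a\<in>S. \<Sum>b\<in>S. g (R a b b) a) = (\<Sum>a\<in>T. \<Sum>b\<in>T. g (R a b b) a)"
proof -
  have b1: "bilinear (\<lambda>a a'. g (R a b b) a')" for b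
    unfolding bilinear_def
    by (auto intro!: linearI simp: form_simps linear_add[OF R(1)] linear_cmul[OF R(1)])
  have b2: "bilinear (\<lambda>b b'. g (R a b b') a)" for a
    unfolding bilinear_def
    by (auto intro!: linearI simp: form_simps linear_add[OF R(2)] linear_cmul[OF R(2)]
        linear_add[OF R(3)] linear_cmul[OF R(3)])
  have "(\<Sum>a\<in>S. \<Sum>b\<in>S. g (R a b b) a) = (\<Sum>b\<in>S. \<Sum>a\<in>S. g (R a b b) a)" by (rule sum.swap)
  also have "\<dots> = (\<Sum>b\<in>S. \<Sum>a\<in>T. g (R a b b) a)"
    by (simp only: trace_basis_independent[OF S T eq b1])
  also have "\<dots> = (\<Sum>a\<in>T. \<Sum>b\<in>S. g (R a b b) a)" by (rule sum.swap)
  also have "\<dots> = (\<Sum>a\<in>T. \<Sum>b\<in>T. g (R a b b) a)"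
    by (simp only: trace_basis_independent[OF S T eq b2])
  finally show ?thesis .
qed

end

section \<open>Double sums over pairs and blocks\<close>

lemma double_sum_triangle:
  fixes f :: "nat \<Rightarrow> nat \<Rightarrow> real"
  assumes "\<And>i j. f i j = f j i" "\<And>i. f i i = 0"
  shows "(\<Sum>i<r. \<Sum>j<r. f i j) = 2 * (\<Sum>j<r. \<Sum>i<j. f i j)"
proof (induction r)
  case (Suc r)
  have "(\<Sum>i<Suc r. \<Sum>j<Suc r. f i j) = (\<Sum>i<r. \<Sum>j<r. f i j) + (\<Sum>i<r. f i r) + (\<Sum>j<r. f r j)"
    by (simp add: sum.distrib assms(2))
  also have "(\<Sum>j<r. f r j) = (\<Sum>i<r. f i r)" using assms(1) by (intro sum.cong) auto
  finally show ?case using Suc by simp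
qed simp

text \<open>The off-block part of the double sum of \<open>B (H a) (H b)\<close> equals minus the sum over the blocks
  \<open>A j\<close> of the squared norms of the partial traces \<open>\<Sum>a\<in>A j. H a\<close>, because the full trace vanishes.\<close>

lemma off_block_sum_nonpos:
  fixes Q :: "'a \<Rightarrow> 'a \<Rightarrow> real" and H :: "'a \<Rightarrow> 'w::euclidean_space" and B :: "'w \<Rightarrow> 'w \<Rightarrow> real"
  assumes "finite E" "finite J" and A: "\<And>j. j \<in> J \<Longrightarrow> A j \<subseteq> E"
    and disj: "\<And>i j. i \<in> J \<Longrightarrow> j \<in> J \<Longrightarrow> i \<noteq> j \<Longrightarrow> A i \<inter> A j = {}"
    and B: "bilinear B" "\<And>w. B w w \<ge> 0"
    and trace: "(\<Sum>a\<in>E. H a) = 0"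
    and Q: "\<And>a b. a \<in> E \<Longrightarrow> b \<in> E \<Longrightarrow> Q a b \<le> B (H a) (H b)"
  shows "(\<Sum>a\<in>E. \<Sum>b\<in>E. Q a b) \<le> (\<Sum>j\<in>J. \<Sum>a\<in>A j. \<Sum>b\<in>A j. Q a b)"
proof -
  note l = bilinear_linear[OF B(1)]
  define D where "D = (\<Union>j\<in>J. A j \<times> A j)"
  have D: "D \<subseteq> E \<times> E" using A by (auto simp: D_def)
  have finA: "finite (A j)" if "j \<in> J" for j using A that assms(1) finite_subset by blast
  have sumD: "(\<Sum>(a,b)\<in>D. q a b) = (\<Sum>j\<in>J. \<Sum>a\<in>A j. \<Sum>b\<in>A j. q a b)" for q :: "'a \<Rightarrow> 'a \<Rightarrow> real"
  proof -
    have "(\<Sum>(a,b)\<in>D. q a b) = (\<Sum>j\<in>J. \<Sum>(a,b)\<in>A j \<times> A j. q a b)"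
      unfolding D_def using assms(2) finA disj by (intro sum.UNION_disjoint) auto
    then show ?thesis by (simp add: sum.cartesian_product)
  qed
  have sumB: "(\<Sum>a\<in>X. \<Sum>b\<in>X. B (H a) (H b)) = B (\<Sum>a\<in>X. H a) (\<Sum>a\<in>X. H a)" for X
    by (subst linear_sum[OF l(2)]) (simp add: linear_sum[OF l(1)])
  have "(\<Sum>(a,b)\<in>E\<times>E. Q a b) = (\<Sum>(a,b)\<in>E\<times>E - D. Q a b) + (\<Sum>(a,b)\<in>D. Q a b)"
    using sum.subset_diff[OF D] assms(1) by auto
  \<comment> \<open>Only off-block pairs are estimated; the block sums of \<open>Q\<close> stay
    exact because they reappear on the right-hand side of the claim.\<close>
  moreover have "(\<Sum>(a,b)\<in>E\<times>E - D. Q a b) \<le> (\<Sum>(a,b)\<in>E\<times>E - D. B (H a) (H b))"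
    using Q by (intro sum_mono) auto
  moreover have "(\<Sum>(a,b)\<in>E\<times>E. B (H a) (H b)) = (\<Sum>(a,b)\<in>E\<times>E - D. B (H a) (H b)) + (\<Sum>(a,b)\<in>D. B (H a) (H b))"
    using sum.subset_diff[OF D] assms(1) by auto
  moreover have "(\<Sum>(a,b)\<in>E\<times>E. B (H a) (H b)) = 0"
    by (simp add: sum.cartesian_product[symmetric] sumB trace bilinear_lzero[OF B(1)])
  moreover have "(\<Sum>(a,b)\<in>D. B (H a) (H b)) \<ge> 0"
    unfolding sumD sumB using B(2) by (intro sum_nonneg)
  ultimately have "(\<Sum>(a,b)\<in>E\<times>E. Q a b) \<le> (\<Sum>(a,b)\<in>D. Q a b)" by linarith
  then show ?thesis by (simp add: sumD sum.cartesian_product)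
qed

section \<open>Tangent spaces and charts of a Riemannian manifold\<close>

locale riemannian_mfd =
  fixes M :: "('a, 'n::finite) riemannian"
  assumes riemannian: "riemannian_manifold M"
begin

lemma smooth_mfd: "smooth_manifold M"
  using riemannian by (simp add: riemannian_manifold_def)

lemma chart_open: "c \<in> atlas M \<Longrightarrow> openin (mtop M) (fst c)"
  and chart_image_open: "c \<in> atlas M \<Longrightarrow> open (chart_image c)"
  and chart_homeo: "c \<in> atlas M \<Longrightarrow>
    homeomorphic_map (subtopology (mtop M) (fst c)) (top_of_set (chart_image c)) (snd c)"
  and transition_smooth: "c \<in> atlas M \<Longrightarrow> d \<in> atlas M \<Longrightarrow>
    smooth_on (snd c ` (fst c \<inter> fst d)) (transition c d)"
  using smooth_mfd by (auto simp: smooth_manifold_def)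

lemma chart_subset: "c \<in> atlas M \<Longrightarrow> fst c \<subseteq> topspace (mtop M)"
  using chart_open openin_subset by blast

lemma chart_at_charts: "p \<in> topspace (mtop M) \<Longrightarrow> chart_at M p \<in> charts_at M p"
proof -
  assume "p \<in> topspace (mtop M)"
  then have "p \<in> (\<Union>c\<in>atlas M. fst c)"
    using smooth_mfd by (simp add: smooth_manifold_def)
  then obtain c where "c \<in> charts_at M p" unfolding charts_at_def by blast
  then show ?thesis unfolding chart_at_def by (rule someI)
qed

lemma chart_inj: "c \<in> atlas M \<Longrightarrow> inj_on (snd c) (fst c)"
  using homeomorphic_imp_injective_map[OF chart_homeo] chart_subset
  by (simp add: topspace_subtopology Int_absorb1)

lemma chart_inv_chart: "c \<in> atlas M \<Longrightarrow> q \<in> fst c \<Longrightarrow> chart_inv c (snd c q) = q"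
  unfolding chart_inv_def using chart_inj inv_into_f_f by metis

lemma chart_open_image:
  assumes c: "c \<in> atlas M" and W: "openin (mtop M) W"
  shows "open (snd c ` (fst c \<inter> W))"
proof -
  have "openin (subtopology (mtop M) (fst c)) (fst c \<inter> W)"
    using W by (auto simp: openin_subtopology)
  then have "openin (top_of_set (chart_image c)) (snd c ` (fst c \<inter> W))"
    using homeomorphic_imp_open_map[OF chart_homeo[OF c]] by (simp add: open_map_def)
  then show ?thesis using chart_image_open[OF c] openin_open_trans by blast
qed

lemma transition_chart: "c \<in> atlas M \<Longrightarrow> q \<in> fst c \<Longrightarrow> transition c d (snd c q) = snd d q"
  by (simp add: transition_def chart_inv_chart)

lemma transition_differentiable:
  assumes "c \<in> charts_at M q" "d \<in> charts_at M q"
  shows "transition c d differentiable (at (snd c q))"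
  by (rule smooth_on_differentiable[OF transition_smooth]) (use assms in \<open>auto simp: charts_at_def\<close>)

lemma ddir_transition_self:
  assumes c: "c \<in> charts_at M q"
  shows "ddir (transition c c) (snd c q) = (\<lambda>u. u)"
proof -
  have ca: "c \<in> atlas M" and q: "q \<in> fst c" using c by (auto simp: charts_at_def)
  have "((\<lambda>y. y) has_derivative (\<lambda>u. u)) (at (snd c q))" by (rule has_derivative_ident)
  then have "(transition c c has_derivative (\<lambda>u. u)) (at (snd c q))"
    by (rule has_derivative_transform_within_open[OF _ chart_image_open[OF ca]])
      (use q in \<open>auto simp: chart_image_def transition_chart[OF ca]\<close>)
  then show ?thesis by (rule ddir_has_derivative)
qed

text \<open>The cocycle rule, by the chain rule on the overlap of the charts. It is why
  \<open>coord_vec\<close> produces families satisfying the compatibility condition of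
  \<open>tangent_space\<close>.\<close>

lemma ddir_transition_transition:
  assumes c: "c \<in> charts_at M q" and d: "d \<in> charts_at M q" and e: "e \<in> charts_at M q"
  shows "ddir (transition d e) (snd d q) (ddir (transition c d) (snd c q) u) = ddir (transition c e) (snd c q) u"
proof -
  have ca: "c \<in> atlas M" "d \<in> atlas M" and q: "q \<in> fst c" "q \<in> fst d" 
    using c d by (auto simp: charts_at_def)
  note t = transition_chart[OF ca(1) q(1), of d]
  have "ddir (transition d e) (snd d q) (ddir (transition c d) (snd c q) u) =
      ddir (transition d e \<circ> transition c d) (snd c q) u"
    using ddir_compose[OF transition_differentiable[OF c d], of "transition d e"]
      transition_differentiable[OF d e] t by simp
  also have "ddir (transition d e \<circ> transition c d) (snd c q) = ddir (transition c e) (snd c q)"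
  proof (rule ddir_cong_open[OF chart_open_image[OF ca(1) chart_open[OF ca(2)]]])
    show "snd c q \<in> snd c ` (fst c \<inter> fst d)" using q by blast
    show "(transition d e \<circ> transition c d) y = transition c e y" if "y \<in> snd c ` (fst c \<inter> fst d)" for y
      using that ca by (auto simp: transition_chart)
    show "transition d e \<circ> transition c d differentiable at (snd c q)"
      by (rule differentiable_chain_at)
        (use transition_differentiable[OF c d] transition_differentiable[OF d e] t in auto)
  qed
  finally show ?thesis .
qed

lemma coord_vec_coord: "c \<in> charts_at M q \<Longrightarrow> coord_vec M c q u c = u"
  by (simp add: coord_vec_def ddir_transition_self)

lemma coord_vec_tangent: "c \<in> charts_at M q \<Longrightarrow> coord_vec M c q u \<in> tangent_space M q"
  by (auto simp: tangent_space_def coord_vec_def ddir_transition_transition)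

lemma coord_vec_tangent_coord:
  assumes c: "c \<in> charts_at M q" and v: "v \<in> tangent_space M q"
  shows "coord_vec M c q (v c) = v"
proof
  fix d
  have "v d = ddir (transition c d) (snd c q) (v c)" if "d \<in> charts_at M q"
    using v c that unfolding tangent_space_def by blast
  moreover have "v d = 0" if "d \<notin> charts_at M q"
    using v that unfolding tangent_space_def by blast
  ultimately show "coord_vec M c q (v c) d = v d"
    unfolding coord_vec_def by (cases "d \<in> charts_at M q") simp_all
qed

lemma linear_coord_vec:
  assumes c: "c \<in> charts_at M q"
  shows "linear (coord_vec M c q)"
proof (rule linearI)
  fix u v and r :: real
  show "coord_vec M c q (u + v) = coord_vec M c q u + coord_vec M c q v"
    using linear_add[OF linear_ddir[OF transition_differentiable[OF c]]]
    by (auto simp: coord_vec_def fun_eq_iff)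
  show "coord_vec M c q (r *\<^sub>R v) = r *\<^sub>R coord_vec M c q v"
    using linear_cmul[OF linear_ddir[OF transition_differentiable[OF c]]]
    by (auto simp: coord_vec_def fun_eq_iff scaleR_fun_def)
qed

lemma inj_coord_vec: "c \<in> charts_at M q \<Longrightarrow> inj (coord_vec M c q)"
  by (metis coord_vec_coord injI)

text \<open>The tangent space, a subset of an infinite-looking function space, is a linear injective
  copy of coordinate space; all linear algebra can thus be done in \<open>real^'n\<close>.\<close>

lemma tangent_space_eq:
  assumes c: "c \<in> charts_at M q"
  shows "tangent_space M q = range (coord_vec M c q)"
proof
  show "tangent_space M q \<subseteq> range (coord_vec M c q)"
    using coord_vec_tangent_coord[OF c, symmetric] by (rule range_eqI[THEN subsetI])
qed (use coord_vec_tangent[OF c] in blast)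

lemma chart_metric_coord:
  assumes c: "c \<in> charts_at M q"
  shows "chart_metric M c (snd c q) u v = metric_at M q (coord_vec M c q u) (coord_vec M c q v)"
  using c by (simp add: chart_metric_def chart_inv_chart charts_at_def)

text \<open>The pointwise axioms transfer through the linear injection \<open>coord_vec\<close>;
  smoothness of the chart metric is already part of the manifold axioms.\<close>

lemma metric_on_chart:
  assumes c: "c \<in> atlas M"
  shows "metric_on (chart_image c) (chart_metric M c)"
proof
  show "open (chart_image c)" by (rule chart_image_open[OF c])
  show "smooth_on (chart_image c) (\<lambda>x. chart_metric M c x u v)" for u v
    using riemannian c by (auto simp: riemannian_manifold_def)
next
  fix x assume "x \<in> chart_image c"
  then obtain q where q: "q \<in> fst c" and x: "x = snd c q" by (auto simp: chart_image_def)
  have cq: "c \<in> charts_at M q" using c q by (simp add: charts_at_def)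
  have qt: "q \<in> topspace (mtop M)" using chart_subset[OF c] q by blast
  let ?T = "tangent_space M q"
  have m: "metric_at M q u v = metric_at M q v u"
    "metric_at M q (u + v) w = metric_at M q u w + metric_at M q v w"
    "metric_at M q (a *\<^sub>R u) v = a * metric_at M q u v"
    "u \<noteq> 0 \<Longrightarrow> metric_at M q u u > 0"
    if "u \<in> ?T" "v \<in> ?T" "w \<in> ?T" for u v w a
    using riemannian qt that by (auto simp: riemannian_manifold_def)
  note t = coord_vec_tangent[OF cq]
  note cl = linear_add[OF linear_coord_vec[OF cq]] linear_cmul[OF linear_coord_vec[OF cq]]
  have s: "chart_metric M c x u v = chart_metric M c x v u" for u v
    unfolding x chart_metric_coord[OF cq] by (rule m(1)[OF t t t])
  then show "chart_metric M c x u v = chart_metric M c x v u" for u v .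
  have l: "linear (\<lambda>u. chart_metric M c x u v)" for v
    unfolding x chart_metric_coord[OF cq]
    by (rule linearI) (simp_all add: cl m(2)[OF t t t] m(3)[OF t t t])
  have "linear (chart_metric M c x u)" for u
    using l[of u] s by presburger
  with l show "bilinear (chart_metric M c x)" by (simp add: bilinear_def)
  show "chart_metric M c x u u > 0" if "u \<noteq> 0" for u
    unfolding x chart_metric_coord[OF cq]
    using m(4)[OF t t t] that coord_vec_coord[OF cq, of u] by (metis zero_fun_apply)
qed

end

lemma metric_on_subset:
  assumes "metric_on S G" "T \<subseteq> S" "open T"
  shows "metric_on T G"
  using assms smooth_on_subset unfolding metric_on_def by blast

lemma metric_on_inner_form: "metric_on S G \<Longrightarrow> x \<in> S \<Longrightarrow> inner_form (G x)"
  unfolding metric_on_def inner_form_def by blast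

section \<open>Curvature at one point, in the chart that the definitions choose there\<close>

locale riemannian_point = riemannian_mfd M
  for M :: "('a, 'n::finite) riemannian" +
  fixes p :: 'a
  assumes p: "p \<in> topspace (mtop M)"
begin

abbreviation "c \<equiv> chart_at M p"
abbreviation "tvec \<equiv> coord_vec M c p"
abbreviation "form \<equiv> chart_metric M c (snd c p)"
abbreviation "riem \<equiv> chart_curvature (chart_metric M c) (snd c p)"

lemmas cp = chart_at_charts[OF p]

lemma c_atlas: "c \<in> atlas M" and p_in_c: "p \<in> fst c"
  using cp by (auto simp: charts_at_def)

lemma x_in: "snd c p \<in> chart_image c"
  using p_in_c by (auto simp: chart_image_def)

sublocale chart: metric_on "chart_image c" "chart_metric M c"
  by (rule metric_on_chart[OF c_atlas])

sublocale inner_form form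
  by (rule metric_on_inner_form[OF chart.metric_on_axioms x_in])

lemma metric_vec: "metric_at M p (tvec u) (tvec v) = form u v"
  by (rule chart_metric_coord[OF cp, symmetric])

text \<open>The numerator of sectional curvature. It agrees with it on orthonormal pairs but also
  makes sense for \<open>u = v\<close>, where it is 0, so double sums may include the
  diagonal.\<close>

definition sect :: "real^'n \<Rightarrow> real^'n \<Rightarrow> real"
  where "sect u v = form (riem u v v) u"

lemma sect_sym: "sect u v = sect v u"
  unfolding sect_def by (rule chart.sectional_form_sym[OF x_in])

lemma sect_self: "sect u u = 0"
  by (simp add: sect_def chart_curvature_def form_simps)

lemma curvature_vec: "curvature M p (tvec u) (tvec v) (tvec w) = tvec (riem u v w)"
  by (simp add: curvature_def Let_def coord_vec_coord[OF cp])

lemma sectional_curvature_vec: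
  assumes "form u u = 1" "form v v = 1" "form u v = 0"
  shows "sectional_curvature M p (tvec u) (tvec v) = sect u v"
  using assms by (simp add: sectional_curvature_def curvature_vec metric_vec sect_def)

lemma dim_vec_image:
  assumes "orthonormal S"
  shows "dim (tvec ` span S) = card S"
proof -
  have "independent (tvec ` S)"
    by (rule linear_independent_injective_image[OF linear_coord_vec[OF cp] orthonormal_independent[OF assms]])
      (rule inj_on_subset[OF inj_coord_vec[OF cp]], simp)
  then have "dim (span (tvec ` S)) = card (tvec ` S)"
    by (rule dim_span_eq_card_independent)
  then show ?thesis
    by (simp add: linear_span_image[OF linear_coord_vec[OF cp]] card_image inj_on_subset[OF inj_coord_vec[OF cp]])
qed

text \<open>Translates an indexed basis of tangent vectors, as delivered by a SOME-choice, into an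
  orthonormal set of coordinate vectors. Indexing is injective because two equal members would have
  product 1 and 0 at once.\<close>

lemma orthonormal_basis_ofD:
  assumes e: "orthonormal_basis_of M p L r e" and L: "L \<subseteq> tangent_space M p"
  obtains b where "\<And>i. i < r \<Longrightarrow> e i = tvec (b i)" "inj_on b {..<r}" "orthonormal (b ` {..<r})"
    "tvec ` span (b ` {..<r}) = L"
proof -
  define b where "b i = e i c" for i
  have b: "e i = tvec (b i)" if "i < r" for i
    using e L that coord_vec_tangent_coord[OF cp, of "e i"] by (auto simp: orthonormal_basis_of_def b_def)
  have f: "form (b i) (b j) = (if i = j then 1 else 0)" if "i < r" "j < r" for i j
    using e that b metric_vec[of "b i" "b j"] by (simp add: orthonormal_basis_of_def)
  have inj: "inj_on b {..<r}"
    by (rule inj_onI) (metis f lessThan_iff zero_neq_one)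
  moreover have "orthonormal (b ` {..<r})"
    using f inj by (auto simp: orthonormal_def inj_on_def)
  moreover have "tvec ` span (b ` {..<r}) = L"
  proof -
    have "e ` {..<r} = tvec ` b ` {..<r}" using b by (force simp: image_iff)
    then show ?thesis
      using e linear_span_image[OF linear_coord_vec[OF cp], of "b ` {..<r}"]
      by (simp add: orthonormal_basis_of_def)
  qed
  ultimately show ?thesis using that b by blast
qed

lemma orthonormal_basis_ofI:
  assumes "inj_on b {..<r}" "orthonormal (b ` {..<r})"
  shows "orthonormal_basis_of M p (tvec ` span (b ` {..<r})) r (\<lambda>i. tvec (b i))"
  unfolding orthonormal_basis_of_def
proof (intro conjI allI impI)
  show "tvec (b i) \<in> tvec ` span (b ` {..<r})" if "i < r" for i
    using that by (auto intro: span_base)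
  show "span ((\<lambda>i. tvec (b i)) ` {..<r}) = tvec ` span (b ` {..<r})"
    using linear_span_image[OF linear_coord_vec[OF cp], of "b ` {..<r}"] by (simp add: image_image)
  show "metric_at M p (tvec (b i)) (tvec (b j)) = (if i = j then 1 else 0)" if "i < r" "j < r" for i j
    using assms that by (auto simp: metric_vec orthonormal_def inj_on_eq_iff)
qed

lemma orthonormal_basis_exists:
  assumes "orthonormal S"
  shows "\<exists>e. orthonormal_basis_of M p (tvec ` span S) (card S) e"
proof -
  obtain b where "bij_betw b {..<card S} S"
    using assms ex_bij_betw_nat_finite[of S] by (auto simp: orthonormal_def atLeast0LessThan)
  then have b: "inj_on b {..<card S}" "b ` {..<card S} = S" by (auto simp: bij_betw_def)
  have "orthonormal (b ` {..<card S})" using b assms by simp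
  from orthonormal_basis_ofI[OF b(1) this] show ?thesis unfolding b(2) by blast
qed

text \<open>The basis picked by SOME is exchanged for the given \<open>S\<close> by
  \<open>double_trace_basis_independent\<close>; the factor 2 counts each unordered pair in both
  orders.\<close>

lemma scalar_curvature_sub_eq:
  assumes S: "orthonormal S"
  shows "2 * scalar_curvature_sub M p (tvec ` span S) = (\<Sum>a\<in>S. \<Sum>b\<in>S. sect a b)"
proof -
  let ?L = "tvec ` span S" and ?r = "card S"
  define e where "e = (SOME e. orthonormal_basis_of M p ?L ?r e)"
  have e: "orthonormal_basis_of M p ?L ?r e"
    unfolding e_def using orthonormal_basis_exists[OF S] by (rule someI_ex)
  have "?L \<subseteq> tangent_space M p" using coord_vec_tangent[OF cp] by blast
  from orthonormal_basis_ofD[OF e this] obtain b where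
    b: "\<And>i. i < ?r \<Longrightarrow> e i = tvec (b i)" "inj_on b {..<?r}" "orthonormal (b ` {..<?r})"
    and bL: "tvec ` span (b ` {..<?r}) = ?L" by blast
  have sp: "span (b ` {..<?r}) = span S"
    using bL inj_coord_vec[OF cp] by (simp add: inj_image_eq_iff)
  have f: "form (b i) (b j) = (if i = j then 1 else 0)" if "i < ?r" "j < ?r" for i j
    using b(2,3) that by (auto simp: orthonormal_def inj_on_eq_iff)
  have "scalar_curvature_sub M p ?L = (\<Sum>j<?r. \<Sum>i<j. sectional_curvature M p (e i) (e j))"
    by (simp add: scalar_curvature_sub_def Let_def dim_vec_image[OF S] e_def)
  also have "\<dots> = (\<Sum>j<?r. \<Sum>i<j. sect (b i) (b j))"
    by (intro sum.cong refl) (simp add: b(1) sectional_curvature_vec f)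
  finally have "2 * scalar_curvature_sub M p ?L = (\<Sum>i<?r. \<Sum>j<?r. sect (b i) (b j))"
    using double_sum_triangle[of "\<lambda>i j. sect (b i) (b j)" ?r] sect_sym sect_self by simp
  also have "\<dots> = (\<Sum>a\<in>b ` {..<?r}. \<Sum>a'\<in>b ` {..<?r}. sect a a')"
    by (simp add: sum.reindex[OF b(2)])
  also have "\<dots> = (\<Sum>a\<in>S. \<Sum>b\<in>S. sect a b)"
    unfolding sect_def
    by (rule double_trace_basis_independent[OF b(3) S sp chart.linear_chart_curvature[OF x_in]])
  finally show ?thesis .
qed

lemma scalar_curvature_eq:
  assumes "orthonormal S" "span S = UNIV"
  shows "2 * scalar_curvature M p = (\<Sum>a\<in>S. \<Sum>b\<in>S. sect a b)"
  using scalar_curvature_sub_eq[OF assms(1)] assms(2)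
  by (simp add: scalar_curvature_def tangent_space_eq[OF cp])

lemma orthonormal_basis_UNIV: "\<exists>E. orthonormal E \<and> span E = UNIV"
  using orthonormal_extend[OF orthonormal_empty, of UNIV] by auto

lemma card_orthonormal_basis: "orthonormal E \<Longrightarrow> span E = UNIV \<Longrightarrow> card E = CARD('n)"
  using orthonormal_independent dim_span_eq_card_independent by (metis DIM_cart DIM_real dim_UNIV mult_1_right)

text \<open>Orthonormal bases of the single subspaces have an orthonormal union, since different
  subspaces are orthogonal; this union extends to a basis adapted to all of them.\<close>

lemma orthogonal_subspaces_blocks:
  assumes Ls: "orthogonal_subspaces M p ns Ls"
  obtains E A where "orthonormal E" "span E = UNIV" "\<And>j. j < length ns \<Longrightarrow> A j \<subseteq> E"
    "\<And>i j. i < length ns \<Longrightarrow> j < length ns \<Longrightarrow> i \<noteq> j \<Longrightarrow> A i \<inter> A j = {}"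
    "\<And>j. j < length ns \<Longrightarrow> tvec ` span (A j) = Ls ! j"
proof -
  have L: "subspace (Ls ! j)" "Ls ! j \<subseteq> tangent_space M p" if "j < length ns" for j
    using Ls that by (auto simp: orthogonal_subspaces_def)
  have orth: "metric_at M p u v = 0" if "i < length ns" "j < length ns" "i \<noteq> j" "u \<in> Ls ! i" "v \<in> Ls ! j" for i j u v
    using Ls that by (auto simp: orthogonal_subspaces_def)
  have "\<exists>A. orthonormal A \<and> tvec ` span A = Ls ! j" if "j < length ns" for j
  proof -
    have "subspace (tvec -` (Ls ! j))"
      using linear_subspace_vimage[OF linear_coord_vec[OF cp] L(1)[OF that]] .
    then obtain A where A: "orthonormal A" "span A = tvec -` (Ls ! j)"
      using orthonormal_extend[OF orthonormal_empty] by blast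
    have "tvec ` (tvec -` (Ls ! j)) = Ls ! j"
      using L(2)[OF that] tangent_space_eq[OF cp] by (auto simp: image_vimage_eq)
    with A show ?thesis by auto
  qed
  then obtain A where A: "orthonormal (A j)" "tvec ` span (A j) = Ls ! j" if "j < length ns" for j
    by metis
  have o: "form a b = 0" if "i < length ns" "j < length ns" "i \<noteq> j" "a \<in> A i" "b \<in> A j" for i j a b
  proof -
    have "tvec a \<in> Ls ! i" "tvec b \<in> Ls ! j"
      using A(2)[OF that(1)] A(2)[OF that(2)] that(4,5) span_base by blast+
    then show ?thesis using orth[OF that(1-3)] by (simp add: metric_vec[symmetric])
  qed
  \<comment> \<open>A common vector would be orthogonal to itself although its norm is 1.\<close>
  have disj: "A i \<inter> A j = {}" if "i < length ns" "j < length ns" "i \<noteq> j" for i j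
  proof -
    have "a \<notin> A j" if "a \<in> A i" for a
      using o[of i j a a] A(1)[of i] that \<open>i < length ns\<close> \<open>j < length ns\<close> \<open>i \<noteq> j\<close>
      by (auto simp: orthonormal_def)
    then show ?thesis by blast
  qed
  have "orthonormal (\<Union>j<length ns. A j)"
    unfolding orthonormal_def
  proof (intro conjI ballI)
    show "finite (\<Union>j<length ns. A j)" using A(1) by (auto simp: orthonormal_def)
    fix a b assume "a \<in> (\<Union>j<length ns. A j)" "b \<in> (\<Union>j<length ns. A j)"
    then obtain i j where ij: "i < length ns" "a \<in> A i" "j < length ns" "b \<in> A j" by auto
    show "form a b = (if a = b then 1 else 0)"
    proof (cases "i = j")
      case True
      then show ?thesis using A(1)[OF ij(1)] ij by (auto simp: orthonormal_def)
    next
      case False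
      then have "a \<noteq> b" using disj[OF ij(1,3)] ij by blast
      then show ?thesis using o[OF ij(1,3) False ij(2,4)] by simp
    qed
  qed
  then obtain E where E: "(\<Union>j<length ns. A j) \<subseteq> E" "orthonormal E" "span E = UNIV"
    using orthonormal_extend[OF _ subspace_UNIV subset_UNIV] by metis
  then have "A j \<subseteq> E" if "j < length ns" for j using that by blast
  then show ?thesis using that[OF E(2,3)] disj A(2) by blast
qed

text \<open>Consecutive segments of an orthonormal basis span subspaces of the prescribed
  dimensions; the bound on the sum guarantees enough basis vectors.\<close>

lemma orthogonal_subspaces_exist:
  assumes ns: "sum_list ns \<le> CARD('n)"
  shows "\<exists>Ls. orthogonal_subspaces M p ns Ls"
proof -
  obtain E where E: "orthonormal E" "span E = UNIV" using orthonormal_basis_UNIV by blast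
  obtain b where "bij_betw b {..<CARD('n)} E"
    using E card_orthonormal_basis ex_bij_betw_nat_finite[of E]
    by (auto simp: orthonormal_def atLeast0LessThan)
  then have b: "inj_on b {..<CARD('n)}" "b ` {..<CARD('n)} = E" by (auto simp: bij_betw_def)
  \<comment> \<open>Partial sums mark the ends of the segments. Past the end of \<open>ns\<close>
    they are constant, so \<open>I j\<close> is empty there and inclusion and disjointness hold for
    every index.\<close>
  define s where "s j = sum_list (take j ns)" for j
  define I where "I j = {s j..<s (Suc j)}" for j
  define A where "A j = b ` I j" for j
  have s_Suc: "s (Suc j) = s j + ns ! j" if "j < length ns" for j
    using that by (simp add: s_def take_Suc_conv_app_nth)
  have s_mono: "s i \<le> s j" if "i \<le> j" for i j
  proof -
    have "take j ns = take i ns @ take (j - i) (drop i ns)"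
      using that by (metis le_add_diff_inverse take_add)
    then show ?thesis by (simp add: s_def)
  qed
  have s_le: "s j \<le> CARD('n)" for j
  proof -
    have "s j \<le> s (max j (length ns))" by (rule s_mono) simp
    also have "\<dots> = sum_list ns" by (simp add: s_def)
    finally show ?thesis using ns by simp
  qed
  have I: "I j \<subseteq> {..<CARD('n)}" for j using s_le[of "Suc j"] by (auto simp: I_def)
  have disjI: "I i \<inter> I j = {}" if "i < j" for i j
    using s_mono[of "Suc i" j] that by (auto simp: I_def)
  have disj: "A i \<inter> A j = {}" if "i \<noteq> j" for i j
    using disjI[of i j] disjI[of j i] that I[of i] I[of j] b(1)
    unfolding A_def by (metis image_empty inf_commute inj_on_image_Int nat_neq_iff)
  have A: "A j \<subseteq> E" for j using I[of j] b(2) by (auto simp: A_def)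
  have cardA: "card (A j) = ns ! j" if "j < length ns" for j
    using card_image[OF inj_on_subset[OF b(1) I[of j]]] s_Suc[OF that] by (simp add: A_def I_def)
  have zero: "form u v = 0" if "i \<noteq> j" "u \<in> span (A i)" "v \<in> span (A j)" for i j u v
  proof -
    have ab: "form a b = 0" if "a \<in> A i" "b \<in> A j" for a b
    proof -
      have "a \<in> E" "b \<in> E" "a \<noteq> b" using that A disj[OF \<open>i \<noteq> j\<close>] by blast+
      then show ?thesis using E(1) by (simp add: orthonormal_def)
    qed
    have "form a v = 0" if "a \<in> A i" for a
      using linear_eq_0_on_span[OF bilinear_linear(1)[OF bilinear_form, of a] ab[OF that] \<open>v \<in> span (A j)\<close>] by simp
    from linear_eq_0_on_span[OF bilinear_linear(2)[OF bilinear_form, of v] this \<open>u \<in> span (A i)\<close>] show ?thesis by simp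
  qed
  have "orthogonal_subspaces M p ns (map (\<lambda>j. tvec ` span (A j)) [0..<length ns])"
    unfolding orthogonal_subspaces_def
    using zero metric_vec coord_vec_tangent[OF cp] cardA dim_vec_image[OF orthonormal_subset[OF E(1) A]]
    by (auto intro!: linear_subspace_image[OF linear_coord_vec[OF cp]])
  then show ?thesis by blast
qed

text \<open>A common lower bound passes to \<open>Inf\<close> on the reals only for a nonempty set,
  hence the appeal to \<open>orthogonal_subspaces_exist\<close>.\<close>

lemma delta_invariant_nonpos:
  assumes "sum_list ns \<le> CARD('n)"
    and le: "\<And>Ls. orthogonal_subspaces M p ns Ls \<Longrightarrow> scalar_curvature M p \<le> (\<Sum>L\<leftarrow>Ls. scalar_curvature_sub M p L)"
  shows "delta_invariant M ns p \<le> 0"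
proof -
  have "scalar_curvature M p \<le> Inf {\<Sum>L\<leftarrow>Ls. scalar_curvature_sub M p L |Ls. orthogonal_subspaces M p ns Ls}"
    using orthogonal_subspaces_exist[OF assms(1)] le by (intro cInf_greatest) auto
  then show ?thesis by (simp add: delta_invariant_def)
qed

end

section \<open>Isometric immersions\<close>

locale isometric_immersion_on =
  dom: riemannian_mfd M + cod: riemannian_mfd N
  for M :: "('a, 'n::finite) riemannian" and N :: "('b, 'm::finite) riemannian" +
  fixes f :: "'a \<Rightarrow> 'b"
  assumes immersion: "isometric_immersion M N f"
begin

lemma continuous_f: "continuous_map (mtop M) (mtop N) f"
  and local_rep_smooth: "c \<in> atlas M \<Longrightarrow> d \<in> atlas N \<Longrightarrow>
    smooth_on (snd c ` (fst c \<inter> f -` fst d)) (local_rep c d f)"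
  using immersion by (auto simp: isometric_immersion_def smooth_map_def)

lemma f_topspace: "q \<in> topspace (mtop M) \<Longrightarrow> f q \<in> topspace (mtop N)"
  using continuous_f by (auto simp: continuous_map_def)

lemma local_rep_chart: "c \<in> atlas M \<Longrightarrow> q \<in> fst c \<Longrightarrow> local_rep c d f (snd c q) = snd d (f q)"
  by (simp add: local_rep_def dom.chart_inv_chart)

lemma local_rep_domain_open:
  assumes c: "c \<in> atlas M" and d: "d \<in> atlas N"
  shows "open (snd c ` (fst c \<inter> f -` fst d))"
proof -
  have "openin (mtop M) {q \<in> topspace (mtop M). f q \<in> fst d}"
    by (rule openin_continuous_map_preimage[OF continuous_f cod.chart_open[OF d]])
  moreover have "fst c \<inter> f -` fst d = fst c \<inter> {q \<in> topspace (mtop M). f q \<in> fst d}"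
    using dom.chart_subset[OF c] by blast
  ultimately show ?thesis using dom.chart_open_image[OF c] by simp
qed

lemma local_rep_differentiable:
  assumes "c \<in> charts_at M q" "d \<in> charts_at N (f q)"
  shows "local_rep c d f differentiable (at (snd c q))"
  by (rule smooth_on_differentiable[OF local_rep_smooth]) (use assms in \<open>auto simp: charts_at_def\<close>)

text \<open>Chain rule: changing the target chart acts on the derivative by the transition map. The
  next lemma does the same for the source chart.\<close>

lemma ddir_local_rep_target:
  assumes c: "c \<in> charts_at M q" and d: "d \<in> charts_at N (f q)" and e: "e \<in> charts_at N (f q)"
  shows "ddir (transition d e) (snd d (f q)) (ddir (local_rep c d f) (snd c q) u)
    = ddir (local_rep c e f) (snd c q) u"
proof -
  have ca: "c \<in> atlas M" "d \<in> atlas N" and q: "q \<in> fst c" "f q \<in> fst d"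
    using c d by (auto simp: charts_at_def)
  note r = local_rep_chart[OF ca(1) q(1), of d]
  have t: "transition d e differentiable at (local_rep c d f (snd c q))"
    using cod.transition_differentiable[OF d e] r by simp
  have "ddir (transition d e) (snd d (f q)) (ddir (local_rep c d f) (snd c q) u) =
      ddir (transition d e \<circ> local_rep c d f) (snd c q) u"
    using ddir_compose[OF local_rep_differentiable[OF c d] t] r by simp
  also have "ddir (transition d e \<circ> local_rep c d f) (snd c q) = ddir (local_rep c e f) (snd c q)"
  proof (rule ddir_cong_open[OF local_rep_domain_open[OF ca]])
    show "snd c q \<in> snd c ` (fst c \<inter> f -` fst d)" using q by blast
    show "(transition d e \<circ> local_rep c d f) y = local_rep c e f y"
      if "y \<in> snd c ` (fst c \<inter> f -` fst d)" for y
      using that ca by (auto simp: local_rep_chart cod.transition_chart)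
    show "transition d e \<circ> local_rep c d f differentiable at (snd c q)"
      by (rule differentiable_chain_at[OF local_rep_differentiable[OF c d] t])
  qed
  finally show ?thesis .
qed

lemma ddir_local_rep_source:
  assumes c: "c \<in> charts_at M q" and c': "c' \<in> charts_at M q" and e: "e \<in> charts_at N (f q)"
  shows "ddir (local_rep c' e f) (snd c' q) (ddir (transition c c') (snd c q) u)
    = ddir (local_rep c e f) (snd c q) u"
proof -
  have ca: "c \<in> atlas M" "c' \<in> atlas M" and q: "q \<in> fst c" "q \<in> fst c'"
    using c c' by (auto simp: charts_at_def)
  note r = dom.transition_chart[OF ca(1) q(1), of c']
  have t: "local_rep c' e f differentiable at (transition c c' (snd c q))"
    using local_rep_differentiable[OF c' e] r by simp
  have "ddir (local_rep c' e f) (snd c' q) (ddir (transition c c') (snd c q) u) =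
      ddir (local_rep c' e f \<circ> transition c c') (snd c q) u"
    using ddir_compose[OF dom.transition_differentiable[OF c c'] t] r by simp
  also have "ddir (local_rep c' e f \<circ> transition c c') (snd c q) = ddir (local_rep c e f) (snd c q)"
  proof (rule ddir_cong_open[OF dom.chart_open_image[OF ca(1) dom.chart_open[OF ca(2)]]])
    show "snd c q \<in> snd c ` (fst c \<inter> fst c')" using q by blast
    show "(local_rep c' e f \<circ> transition c c') y = local_rep c e f y"
      if "y \<in> snd c ` (fst c \<inter> fst c')" for y
      using that ca by (auto simp: local_rep_chart dom.transition_chart)
    show "local_rep c' e f \<circ> transition c c' differentiable at (snd c q)"
      by (rule differentiable_chain_at[OF dom.transition_differentiable[OF c c'] t])
  qed
  finally show ?thesis .
qed

text \<open>\<open>differential\<close> uses the chart chosen at \<open>q\<close>, which may change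
  from point to point. The pullback identity has to be differentiated, hence must hold throughout
  one fixed chart, so the differential is needed in arbitrary charts.\<close>

lemma differential_coord_vec:
  assumes q: "q \<in> topspace (mtop M)" and c: "c \<in> charts_at M q" and d: "d \<in> charts_at N (f q)"
  shows "differential M N f q (coord_vec M c q u) = coord_vec N d (f q) (ddir (local_rep c d f) (snd c q) u)"
proof
  fix e
  note c' = dom.chart_at_charts[OF q]
  show "differential M N f q (coord_vec M c q u) e
      = coord_vec N d (f q) (ddir (local_rep c d f) (snd c q) u) e"
    by (simp add: differential_def Let_def coord_vec_def c'
        ddir_local_rep_source[OF c c'] ddir_local_rep_target[OF c d])
qed

lemma pullback_metric:
  assumes c: "c \<in> charts_at M q" and d: "d \<in> charts_at N (f q)"
  shows "chart_metric M c (snd c q) u v =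
    chart_metric N d (local_rep c d f (snd c q)) (ddir (local_rep c d f) (snd c q) u) (ddir (local_rep c d f) (snd c q) v)"
proof -
  have ca: "c \<in> atlas M" "q \<in> fst c" using c by (auto simp: charts_at_def)
  then have q: "q \<in> topspace (mtop M)" using dom.chart_subset by blast
  have "metric_at M q (coord_vec M c q u) (coord_vec M c q v) =
    metric_at N (f q) (differential M N f q (coord_vec M c q u)) (differential M N f q (coord_vec M c q v))"
    using immersion q dom.coord_vec_tangent[OF c] by (simp add: isometric_immersion_def)
  then show ?thesis
    by (simp add: dom.chart_metric_coord[OF c] local_rep_chart[OF ca] cod.chart_metric_coord[OF d]
        differential_coord_vec[OF q c d])
qed

text \<open>Hands the immersion over to the coordinate Gauss equation. The source chart is cut down
  to the points sent into \<open>d\<close>, an open set by continuity of \<open>f\<close>.\<close>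

lemma isometric_chart_local_rep:
  assumes c: "c \<in> atlas M" and d: "d \<in> atlas N"
  shows "isometric_chart (snd c ` (fst c \<inter> f -` fst d)) (chart_metric M c)
    (chart_image d) (chart_metric N d) (local_rep c d f)"
proof (intro isometric_chart.intro isometric_chart_axioms.intro)
  let ?U = "snd c ` (fst c \<inter> f -` fst d)"
  show "metric_on ?U (chart_metric M c)"
    by (rule metric_on_subset[OF dom.metric_on_chart[OF c] _ local_rep_domain_open[OF c d]])
      (auto simp: chart_image_def)
  show "metric_on (chart_image d) (chart_metric N d)" by (rule cod.metric_on_chart[OF d])
  show "smooth_on ?U (local_rep c d f)" by (rule local_rep_smooth[OF c d])
  fix x assume "x \<in> ?U"
  then obtain q where q: "q \<in> fst c" "f q \<in> fst d" "x = snd c q" by blast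
  show "local_rep c d f x \<in> chart_image d"
    unfolding q(3) local_rep_chart[OF c q(1)] chart_image_def using q(2) by (rule imageI)
  show "chart_metric M c x u v =
    chart_metric N d (local_rep c d f x) (ddir (local_rep c d f) x u) (ddir (local_rep c d f) x v)" for u v
    unfolding q(3) by (rule pullback_metric) (use q c d in \<open>auto simp: charts_at_def\<close>)
qed

end

section \<open>The curvature inequality at a point of a minimal submanifold\<close>

locale minimal_at_point =
  isometric_immersion_on M N f + source: riemannian_point M p + image: riemannian_point N "f p"
  for M :: "('a, 'n::finite) riemannian" and N :: "('b, 'm::finite) riemannian" and f and p +
  assumes mean_curvature_0: "mean_curvature M N f p = 0"
    and nonpositive: "nonpositive_sectional_curvature N"
begin

abbreviation "F \<equiv> local_rep source.c image.c f"
abbreviation "x \<equiv> snd source.c p"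
abbreviation "U \<equiv> snd source.c ` (fst source.c \<inter> f -` fst image.c)"

sublocale rep: isometric_chart U "chart_metric M source.c" "chart_image image.c" "chart_metric N image.c" F
  by (rule isometric_chart_local_rep[OF source.c_atlas image.c_atlas])

lemma x_in_U: "x \<in> U"
  using source.p_in_c image.p_in_c by blast

lemma F_x: "F x = snd image.c (f p)"
  by (rule local_rep_chart[OF source.c_atlas source.p_in_c])

abbreviation "h \<equiv> rep.sff x"
abbreviation "df \<equiv> ddir F x"

lemma second_fundamental_form_tvec:
  "second_fundamental_form M N f p (source.tvec u) (source.tvec v) = image.tvec (h u v)"
  by (simp add: second_fundamental_form_def Let_def dom.coord_vec_coord[OF source.cp]
      rep.sff_def rep.cov_def)

text \<open>\<open>mean_curvature\<close> uses some chosen basis, but the trace of the bilinear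
  \<open>h\<close> is the same in \<open>E\<close>; the factor \<open>1 / CARD('n)\<close> is
  nonzero and \<open>image.tvec\<close> is injective.\<close>

lemma trace_h:
  assumes E: "source.orthonormal E" "span E = UNIV"
  shows "(\<Sum>a\<in>E. h a a) = 0"
proof -
  let ?n = "CARD('n)"
  define e where "e = (SOME e. orthonormal_basis_of M p (tangent_space M p) ?n e)"
  have "\<exists>e. orthonormal_basis_of M p (tangent_space M p) ?n e"
    using source.orthonormal_basis_exists[OF E(1)] E source.card_orthonormal_basis[OF E]
    by (simp add: dom.tangent_space_eq[OF source.cp])
  then have e: "orthonormal_basis_of M p (tangent_space M p) ?n e"
    unfolding e_def by (rule someI_ex)
  from source.orthonormal_basis_ofD[OF e subset_refl] obtain b where
    b: "\<And>i. i < ?n \<Longrightarrow> e i = source.tvec (b i)" "inj_on b {..<?n}" "source.orthonormal (b ` {..<?n})"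
    and bL: "source.tvec ` span (b ` {..<?n}) = tangent_space M p" by blast
  have "span (b ` {..<?n}) = UNIV"
    using bL dom.inj_coord_vec[OF source.cp]
    unfolding dom.tangent_space_eq[OF source.cp] by (simp only: inj_image_eq_iff)
  then have sp: "span E = span (b ` {..<?n})" using E by simp
  note l = dom.linear_coord_vec[OF source.cp] and l' = cod.linear_coord_vec[OF image.cp]
  have "mean_curvature M N f p = (1 / ?n) *\<^sub>R (\<Sum>i<?n. second_fundamental_form M N f p (e i) (e i))"
    unfolding mean_curvature_def e_def Let_def ..
  also have "(\<Sum>i<?n. second_fundamental_form M N f p (e i) (e i)) = (\<Sum>i<?n. image.tvec (h (b i) (b i)))"
    by (intro sum.cong refl) (simp add: b(1) second_fundamental_form_tvec)
  also have "\<dots> = image.tvec (\<Sum>i<?n. h (b i) (b i))" by (rule linear_sum[OF l', symmetric])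
  also have "(\<Sum>i<?n. h (b i) (b i)) = (\<Sum>a\<in>b ` {..<?n}. h a a)" by (simp add: sum.reindex[OF b(2)])
  also have "\<dots> = (\<Sum>a\<in>E. h a a)"
    by (rule source.trace_basis_independent[OF E(1) b(3) sp rep.bilinear_sff[OF x_in_U], symmetric])
  finally have "(1 / ?n) *\<^sub>R image.tvec (\<Sum>a\<in>E. h a a) = 0"
    using mean_curvature_0 by (rule trans[OF sym])
  then have "image.tvec (\<Sum>a\<in>E. h a a) = image.tvec 0"
    unfolding scaleR_eq_0_iff linear_0[OF l'] by simp
  with cod.inj_coord_vec[OF image.cp] show ?thesis by (rule injD)
qed

text \<open>On the diagonal the left side is 0 and the right side a squared norm. Otherwise the
  Gauss equation applies, and dropping \<open>- |h(a,b)|^2\<close> only weakens the bound.\<close>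

lemma sect_le:
  assumes E: "source.orthonormal E" and ab: "a \<in> E" "b \<in> E"
  shows "source.sect a b \<le> image.form (h a a) (h b b)"
proof -
  have nonneg: "image.form w w \<ge> 0" for w
    using image.form_pos[of w] by (cases "w = 0") (auto simp: image.form_simps)
  show ?thesis
  proof (cases "a = b")
    case True
    then show ?thesis using nonneg by (simp add: source.sect_self)
  next
    case False
    \<comment> \<open>The isometry keeps the pair orthonormal, so its image is independent, which
      the curvature hypothesis on \<open>N\<close> demands, and the denominator of its sectional
      curvature is 1.\<close>
    have on: "image.form (df u) (df v) = (if u = v then 1 else 0)" if "u \<in> {a, b}" "v \<in> {a, b}" for u v
      using E ab that rep.pullback[OF x_in_U, of u v] by (auto simp: source.orthonormal_def F_x)
    have neq: "df a \<noteq> df b" using on[of a b] on[of a a] False by auto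
    have "image.orthonormal {df a, df b}"
      using on False neq by (simp add: image.orthonormal_def)
    then have "independent (image.tvec ` {df a, df b})"
      by (intro linear_independent_injective_image[OF cod.linear_coord_vec[OF image.cp]
            image.orthonormal_independent] inj_on_subset[OF cod.inj_coord_vec[OF image.cp]]) auto
    moreover have "image.tvec (df a) \<noteq> image.tvec (df b)"
      using neq cod.inj_coord_vec[OF image.cp] by (simp add: inj_eq)
    ultimately have "sectional_curvature N (f p) (image.tvec (df a)) (image.tvec (df b)) \<le> 0"
      using nonpositive image.p cod.coord_vec_tangent[OF image.cp]
      by (simp add: nonpositive_sectional_curvature_def)
    then have K: "image.sect (df a) (df b) \<le> 0"
      using on False by (simp add: image.sectional_curvature_vec)
    have "source.sect a b = image.sect (df a) (df b) + image.form (h b b) (h a a) - image.form (h a b) (h b a)"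
      unfolding source.sect_def image.sect_def rep.gauss_equation[OF x_in_U] F_x ..
    also have "\<dots> \<le> image.form (h a a) (h b b)"
      using K nonneg[of "h a b"] image.form_sym[of "h b b"] rep.sff_sym[OF x_in_U, of b a] by simp
    finally show ?thesis .
  qed
qed

lemma scalar_curvature_le:
  assumes Ls: "orthogonal_subspaces M p ns Ls"
  shows "scalar_curvature M p \<le> (\<Sum>L\<leftarrow>Ls. scalar_curvature_sub M p L)"
proof -
  from source.orthogonal_subspaces_blocks[OF Ls] obtain E A where
    E: "source.orthonormal E" "span E = UNIV" and A: "\<And>j. j < length ns \<Longrightarrow> A j \<subseteq> E"
    and disj: "\<And>i j. i < length ns \<Longrightarrow> j < length ns \<Longrightarrow> i \<noteq> j \<Longrightarrow> A i \<inter> A j = {}"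
    and L: "\<And>j. j < length ns \<Longrightarrow> source.tvec ` span (A j) = Ls ! j"
    by blast
  have "2 * scalar_curvature M p = (\<Sum>a\<in>E. \<Sum>b\<in>E. source.sect a b)"
    by (rule source.scalar_curvature_eq[OF E])
  also have "\<dots> \<le> (\<Sum>j\<in>{..<length ns}. \<Sum>a\<in>A j. \<Sum>b\<in>A j. source.sect a b)"
  \<comment> \<open>Only the diagonal values of the second fundamental form enter, so the vanishing
    total required here is \<open>trace_h\<close>.\<close>
  proof (rule off_block_sum_nonpos[where H="\<lambda>a. h a a" and B=image.form])
    show "image.form w w \<ge> 0" for w
      using image.form_pos[of w] by (cases "w = 0") (auto simp: image.form_simps)
  qed (use E A disj trace_h[OF E] sect_le[OF E(1)] image.bilinear_form in \<open>auto simp: source.orthonormal_def\<close>)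
  also have "\<dots> = (\<Sum>j<length ns. 2 * scalar_curvature_sub M p (Ls ! j))"
    using source.scalar_curvature_sub_eq[OF source.orthonormal_subset[OF E(1) A]] L
    by (intro sum.cong) auto
  also have "\<dots> = 2 * (\<Sum>L\<leftarrow>Ls. scalar_curvature_sub M p L)"
    using Ls by (simp add: sum_list_sum_nth orthogonal_subspaces_def sum_distrib_left atLeast0LessThan)
  finally show ?thesis by simp
qed

end

text \<open>Stated for a single target with its own dimension type, so that both halves of the final
  theorem are instances.\<close>

lemma no_minimal_immersion:
  fixes M :: "('a, 'n::finite) riemannian" and N :: "('b, 'm::finite) riemannian"
  assumes M: "riemannian_manifold M" and N: "riemannian_manifold N" "nonpositive_sectional_curvature N"
    and p: "p \<in> topspace (mtop M)" and ns: "ns \<in> delta_tuples CARD('n)" and pos: "delta_invariant M ns p > 0"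
  shows "\<not> minimal_isometric_immersion M N f"
proof
  assume min: "minimal_isometric_immersion M N f"
  interpret isometric_immersion_on M N f
    using M N min by unfold_locales (auto simp: minimal_isometric_immersion_def)
  interpret minimal_at_point M N f p
    using p f_topspace[OF p] min N by unfold_locales (auto simp: minimal_isometric_immersion_def)
  have "delta_invariant M ns p \<le> 0"
    using source.delta_invariant_nonpos scalar_curvature_le ns by (simp add: delta_tuples_def)
  with pos show False by simp
qed

section \<open>Euclidean space as a flat target\<close>

lemma smooth_on_id: "smooth_on S (id :: 'e::euclidean_space \<Rightarrow> 'e)"
proof -
  have "Ck_on k S (id :: 'e \<Rightarrow> 'e)" for k
    using smooth_on_const[of S] by (cases k) (auto simp: smooth_on_def id_def)
  then show ?thesis by (simp add: smooth_on_def)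
qed

lemma second_countable_euclidean: "second_countable (euclidean :: 'e::second_countable_topology topology)"
proof -
  obtain B :: "'e set set" where "countable B" "topological_basis B"
    using ex_countable_basis by blast
  then show ?thesis
    unfolding second_countable_def by (metis open_openin topological_basisE topological_basis_open)
qed

definition standard_chart :: "(real^'k, 'k::finite) chart"
  where "standard_chart = (UNIV, id)"

lemma standard_chart_simps [simp]: "fst standard_chart = UNIV" "snd standard_chart = id"
  by (simp_all add: standard_chart_def)

lemma euclidean_riemannian_simps:
  "mtop euclidean_riemannian = euclidean"
  "atlas euclidean_riemannian = {standard_chart}"
  "metric_at euclidean_riemannian q u v = u standard_chart \<bullet> v standard_chart"
  by (simp_all add: euclidean_riemannian_def standard_chart_def)

lemma standard_transition: "transition standard_chart standard_chart = id"
  by (simp add: transition_def chart_inv_def)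

lemma euclidean_charts_at: "charts_at euclidean_riemannian q = {standard_chart}"
  by (auto simp: euclidean_riemannian_simps charts_at_def)

lemma euclidean_coord_vec:
  "coord_vec euclidean_riemannian standard_chart q u = (\<lambda>d. if d = standard_chart then u else 0)"
  by (auto simp: coord_vec_def euclidean_charts_at standard_transition ddir_def)

lemma euclidean_chart_metric: "chart_metric euclidean_riemannian standard_chart = (\<lambda>x u v. u \<bullet> v)"
  by (intro ext) (simp add: chart_metric_def Let_def euclidean_riemannian_simps euclidean_coord_vec)

lemma riemannian_manifold_euclidean: "riemannian_manifold euclidean_riemannian"
proof -
  have "homeomorphic_map euclidean euclidean (id :: real^'k \<Rightarrow> real^'k)"
    by (simp add: homeomorphic_map_id)
  then have "smooth_manifold (euclidean_riemannian :: (real^'k, 'k) riemannian)"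
    unfolding smooth_manifold_def euclidean_riemannian_simps
    by (simp add: chart_image_def standard_transition smooth_on_id second_countable_euclidean)
  \<comment> \<open>Definiteness: a tangent vector vanishes on everything outside the atlas, so with
    a single chart one component determines it.\<close>
  moreover have "u standard_chart \<noteq> 0" if "u \<in> tangent_space euclidean_riemannian q" "u \<noteq> 0"
    for u :: "(real^'k, 'k) tangent" and q
  proof
    assume "u standard_chart = 0"
    moreover have "u d = 0" if "d \<noteq> standard_chart" for d
      using \<open>u \<in> _\<close> that unfolding tangent_space_def euclidean_charts_at by blast
    ultimately have "u = 0" by (metis ext zero_fun_apply)
    then show False using that(2) by simp
  qed
  ultimately show ?thesis
    unfolding riemannian_manifold_def
    by (auto simp: euclidean_riemannian_simps euclidean_chart_metric smooth_on_const inner_commute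
        inner_add_left inner_add_right scaleR_fun_def)
qed

text \<open>The metric is constant, so the right-hand side of the Koszul formula is 0, and only the
  zero vector is orthogonal to everything.\<close>

lemma christoffel_inner: "christoffel (\<lambda>x u v. u \<bullet> v) x u v = 0"
proof -
  have "(\<forall>w. z \<bullet> w = 0) \<longleftrightarrow> z = 0" for z :: "real^'k::finite"
    using inner_eq_zero_iff by auto
  then show ?thesis by (simp add: christoffel_def ddir_def)
qed

lemma chart_curvature_inner: "chart_curvature (\<lambda>x u v. u \<bullet> v) x u v w = 0"
  by (simp add: chart_curvature_def christoffel_inner ddir_def)

lemma euclidean_chart_at: "chart_at euclidean_riemannian q = standard_chart"
  by (simp add: chart_at_def euclidean_charts_at)

lemma euclidean_curvature: "curvature euclidean_riemannian q u v w standard_chart = 0"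
  by (simp add: curvature_def Let_def euclidean_chart_at euclidean_coord_vec euclidean_chart_metric
      chart_curvature_inner)

lemma nonpositive_euclidean: "nonpositive_sectional_curvature euclidean_riemannian"
  by (simp add: nonpositive_sectional_curvature_def sectional_curvature_def euclidean_riemannian_simps
      euclidean_curvature)

theorem theorem5p1:
  fixes M :: "('a, 'n::finite) riemannian"
  assumes "riemannian_manifold M"
    and "CARD('n) \<ge> 2"
    and "\<exists>p\<in>topspace (mtop M). \<exists>ns\<in>delta_tuples CARD('n). delta_invariant M ns p > 0"
  shows "(\<forall>(N :: ('b, 'm::finite) riemannian) f.
            riemannian_manifold N \<and> nonpositive_sectional_curvature N \<longrightarrow>
            \<not> minimal_isometric_immersion M N f) \<and>
         (\<forall>f. \<not> minimal_isometric_immersion M (euclidean_riemannian :: (real^'k, 'k::finite) riemannian) f)"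
proof -
  obtain p ns where p: "p \<in> topspace (mtop M)" "ns \<in> delta_tuples CARD('n)" "delta_invariant M ns p > 0"
    using assms(3) by blast
  have "\<not> minimal_isometric_immersion M N f"
    if "riemannian_manifold N" "nonpositive_sectional_curvature N" for N :: "('b, 'm) riemannian" and f
    by (rule no_minimal_immersion[OF assms(1) that p])
  moreover have "\<not> minimal_isometric_immersion M (euclidean_riemannian :: (real^'k, 'k) riemannian) f" for f
    by (rule no_minimal_immersion[OF assms(1) riemannian_manifold_euclidean nonpositive_euclidean p])
  ultimately show ?thesis by blast
qed

end
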